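(* Let $n\ge 1$, let $A=(a_{ij})\in M_n(\mathbb{Z})$ be a skew-symmetric matrix, let $R=\mathbb{C}[X_1,\ldots,X_n]$ be the Poisson algebra with $\{X_i,X_j\}=a_{ij}X_iX_j$, and let $M$ be the Poisson $R$-module which is $R$ as a vector space, with the usual product as $R$-action and with external bracket $\{\cdot,\cdot\}_M$ determined by $\{m,X_i\}_M=-\{X_i,m\}+\left(\sum_{l=1}^n a_{il}\right)X_im$ for all $m\in M$ and $1\le i\le n$. For $0\le k\le n$ let $\dag:\chi^k(R)\to M\otimes_R\Omega^{n-k}(R)$ be the linear isomorphism $$\dag(P)=\sum_{\sigma\in S_{k,n-k}}\varepsilon(\sigma)\,P(X_{\sigma_1},\ldots,X_{\sigma_k})\otimes dX_{\sigma_{k+1}}\wedge\cdots\wedge dX_{\sigma_n}.$$ Then for all $P\in\chi^k(R)$, $$(\dag\circ\delta_k)(P)=(-1)^{k+1}(\partial_{n-k}\circ\dag)(P),$$ where $\delta$ is the Poisson coboundary operator and $\partial$ is the Poisson boundary operator with values in $M$.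
   Context: $S_{k,n-k}$ is the set of permutations $\sigma\in S_n$ with $\sigma_1<\cdots<\sigma_k$ and $\sigma_{k+1}<\cdots<\sigma_n$, where $\sigma_i=\sigma(i)$, and $\varepsilon(\sigma)$ is the sign of $\sigma$. A Poisson algebra is a commutative $\mathbb{C}$-algebra $R$ with a Lie bracket $\{\cdot,\cdot\}$ such that each $\{r,\cdot\}$ is a $\mathbb{C}$-linear derivation of $R$. A Poisson module over $R$ is a $\mathbb{C}$-vector space $M$ with two bilinear maps $\cdot: M\times R\to M$ and $\{\cdot,\cdot\}_M:M\times R\to M$ such that: (1) $(M,\cdot)$ is a (right) module over the commutative algebra $R$; (2) $(M,\{\cdot,\cdot\}_M)$ is a right module over the Lie algebra $(R,\{\cdot,\cdot\})$; (3) $x\cdot\{a,b\}=\{x,a\}_M\cdot b-\{x\cdot b,a\}_M$; (4) $\{x,ab\}_M=\{x,a\}_M\cdot b+\{x,b\}_M\cdot a$, for all $a,b\in R$, $x\in M$. For the module $M$ of the claim, $\{m,a\}_M$ for general $a\in R$ is determined by the values on generators together with (4). $\Omega^k(R)$ is the module of Kähler differential $k$-forms of $R$ over $\mathbb{C}$, and $\partial_k:M\otimes_R\Omega^k(R)\to M\otimes_R\Omega^{k-1}(R)$ is $$\partial_k(m\otimes da_1\wedge\cdots\wedge da_k)=\sum_{i=1}^k(-1)^{i+1}\{m,a_i\}_M\otimes da_1\wedge\cdots\widehat{da_i}\cdots\wedge da_k+\sum_{1\le i<j\le k}(-1)^{i+j}m\otimes d\{a_i,a_j\}\wedge da_1\wedge\cdots\widehat{da_i}\cdots\widehat{da_j}\cdots\wedge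 da_k .$$ $\chi^k(R)$ is the $R$-module of skew-symmetric $k$-linear (over $\mathbb{C}$) maps $R^k\to R$ that are derivations in each argument, and $\delta_k:\chi^k(R)\to\chi^{k+1}(R)$ is $$\delta_k(P)(f_0,\ldots,f_k)=\sum_{i=0}^k(-1)^i\{f_i,P(f_0,\ldots,\widehat{f_i},\ldots,f_k)\}+\sum_{0\le i<j\le k}(-1)^{i+j}P(\{f_i,f_j\},f_0,\ldots,\widehat{f_i},\ldots,\widehat{f_j},\ldots,f_k).$$ Hats denote omitted terms; terms in negative degree are zero. *)

theory Defs
  imports
    "HOL-Analysis.Finite_Cartesian_Product"
    "HOL-Library.Poly_Mapping"
    "HOL-Combinatorics.Permutations"
begin

section \<open>Complex algebras and polynomials\<close>

class complex_vec = ab_group_add +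
  fixes scaleC :: "complex \<Rightarrow> 'a \<Rightarrow> 'a"
  assumes scaleC_add_right: "scaleC c (x + y) = scaleC c x + scaleC c y"
    and scaleC_add_left: "scaleC (c + d) x = scaleC c x + scaleC d x"
    and scaleC_scaleC: "scaleC c (scaleC d x) = scaleC (c * d) x"
    and scaleC_one: "scaleC 1 x = x"

class complex_comm_algebra = complex_vec + comm_ring_1 +
  assumes scaleC_mult_left: "scaleC c x * y = scaleC c (x * y)"

instantiation complex :: complex_comm_algebra
begin
definition scaleC_complex :: "complex \<Rightarrow> complex \<Rightarrow> complex" where
  "scaleC_complex c x = c * x"
instance
  by standard (simp_all add: scaleC_complex_def algebra_simps)
end

text \<open>
  \<open>'x \<Rightarrow>\<^sub>0 'c\<close> is the free \<open>'c\<close>-module on the set \<open>'x\<close>, with the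
  following scalar multiplication; the basis element belonging to \<open>x\<close> is
  \<open>Poly_Mapping.single x 1\<close>.
\<close>

definition fscale :: "'c::comm_ring_1 \<Rightarrow> ('x \<Rightarrow>\<^sub>0 'c) \<Rightarrow> ('x \<Rightarrow>\<^sub>0 'c)" where
  "fscale c f = Poly_Mapping.map ((*) c) f"

lemma lookup_fscale [simp]: "Poly_Mapping.lookup (fscale c f) x = c * Poly_Mapping.lookup f x"
  by (simp add: fscale_def Poly_Mapping.map.rep_eq when_def)

lemma module_fscale:
  "module (fscale :: 'c::comm_ring_1 \<Rightarrow> ('x \<Rightarrow>\<^sub>0 'c) \<Rightarrow> ('x \<Rightarrow>\<^sub>0 'c))"
proof
  fix c d :: 'c and f g :: "'x \<Rightarrow>\<^sub>0 'c"
  show "fscale c (f + g) = fscale c f + fscale c g"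
    by (rule poly_mapping_eqI) (simp add: lookup_add distrib_left)
  show "fscale (c + d) f = fscale c f + fscale d f"
    by (rule poly_mapping_eqI) (simp add: lookup_add distrib_right)
  show "fscale c (fscale d f) = fscale (c * d) f"
    by (rule poly_mapping_eqI) (simp add: mult.assoc)
  show "fscale 1 f = f"
    by (rule poly_mapping_eqI) simp
qed

type_synonym 'n cpoly = "('n \<Rightarrow>\<^sub>0 nat) \<Rightarrow>\<^sub>0 complex"

instantiation poly_mapping :: (comm_monoid_add, complex_comm_algebra) complex_comm_algebra
begin
definition scaleC_poly_mapping ::
    "complex \<Rightarrow> ('a \<Rightarrow>\<^sub>0 'b) \<Rightarrow> ('a \<Rightarrow>\<^sub>0 'b)" where
  "scaleC_poly_mapping c f = fscale (scaleC c 1) f"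

lemma scaleC_poly_mapping_conv:
  "scaleC c f = Poly_Mapping.single 0 (scaleC c 1) * (f :: 'a \<Rightarrow>\<^sub>0 'b)"
  by (simp add: scaleC_poly_mapping_def fscale_def mult_map_scale_conv_mult)

instance
proof
  fix c d :: complex and x y :: "'a \<Rightarrow>\<^sub>0 'b"
  show "scaleC c (x + y) = scaleC c x + scaleC c y"
    by (simp add: scaleC_poly_mapping_conv algebra_simps)
  show "scaleC (c + d) x = scaleC c x + scaleC d x"
    by (simp add: scaleC_poly_mapping_conv scaleC_add_left single_add algebra_simps)
  show "scaleC c (scaleC d x) = scaleC (c * d) x"
    by (simp add: scaleC_poly_mapping_conv mult.assoc[symmetric] mult_single
        scaleC_mult_left scaleC_scaleC)
  show "scaleC 1 x = x"
    by (simp add: scaleC_poly_mapping_conv scaleC_one)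
  show "scaleC c x * y = scaleC c (x * y)"
    by (simp add: scaleC_poly_mapping_conv mult.assoc)
qed

end

definition X :: "'n \<Rightarrow> 'n cpoly" where
  "X i = Poly_Mapping.single (Poly_Mapping.single i 1) 1"


section \<open>Poisson algebras and Poisson modules\<close>

locale poisson_algebra =
  fixes br :: "'r::complex_comm_algebra \<Rightarrow> 'r \<Rightarrow> 'r"
  assumes br_add_left: "br (a + b) c = br a c + br b c"
    and br_scale_left: "br (scaleC z a) c = scaleC z (br a c)"
    and br_add_right: "br a (b + c) = br a b + br a c"
    and br_scale_right: "br a (scaleC z b) = scaleC z (br a b)"
    and br_self: "br a a = 0"
    and br_jacobi: "br a (br b c) + br b (br c a) + br c (br a b) = 0"
    and br_leibniz: "br a (b * c) = br a b * c + b * br a c"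

text \<open>\<open>act\<close> is the right action of \<open>R\<close>, \<open>brM\<close> the external bracket.\<close>

locale poisson_module = poisson_algebra br
  for br :: "'r::complex_comm_algebra \<Rightarrow> 'r \<Rightarrow> 'r" +
  fixes act :: "'m::complex_vec \<Rightarrow> 'r \<Rightarrow> 'm"
    and brM :: "'m \<Rightarrow> 'r \<Rightarrow> 'm"
  assumes act_add_left: "act (x + y) a = act x a + act y a"
    and act_scale_left: "act (scaleC z x) a = scaleC z (act x a)"
    and act_add_right: "act x (a + b) = act x a + act x b"
    and act_scale_right: "act x (scaleC z a) = scaleC z (act x a)"
    and act_mult: "act x (a * b) = act (act x a) b"
    and act_one: "act x 1 = x"
    and brM_add_left: "brM (x + y) a = brM x a + brM y a"
    and brM_scale_left: "brM (scaleC z x) a = scaleC z (brM x a)"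
    and brM_add_right: "brM x (a + b) = brM x a + brM x b"
    and brM_scale_right: "brM x (scaleC z a) = scaleC z (brM x a)"
    and brM_lie: "brM x (br a b) = brM (brM x a) b - brM (brM x b) a"
    and act_br: "act x (br a b) = act (brM x a) b - brM (act x b) a"
    and brM_mult: "brM x (a * b) = act (brM x a) b + act (brM x b) a"


section \<open>Kaehler differential forms\<close>

abbreviation gen :: "'x \<Rightarrow> 'x \<Rightarrow>\<^sub>0 'c::comm_ring_1" where
  "gen x \<equiv> Poly_Mapping.single x 1"

definition spans :: "('x \<Rightarrow>\<^sub>0 'c::comm_ring_1) set \<Rightarrow> ('x \<Rightarrow>\<^sub>0 'c) set" where
  "spans = module.span fscale"

lemma spans_zero: "0 \<in> spans S"
  unfolding spans_def by (rule module.span_zero[OF module_fscale])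

lemma spans_add: "x \<in> spans S \<Longrightarrow> y \<in> spans S \<Longrightarrow> x + y \<in> spans S"
  unfolding spans_def by (rule module.span_add[OF module_fscale])

lemma spans_scale: "x \<in> spans S \<Longrightarrow> fscale c x \<in> spans S"
  unfolding spans_def by (rule module.span_scale[OF module_fscale])

lemma spans_uminus: "x \<in> spans S \<Longrightarrow> - x \<in> spans S"
  unfolding spans_def by (rule module.span_neg[OF module_fscale])

definition cong_mod ::
    "('x \<Rightarrow>\<^sub>0 'c::comm_ring_1) set \<Rightarrow> ('x \<Rightarrow>\<^sub>0 'c) \<Rightarrow> ('x \<Rightarrow>\<^sub>0 'c) \<Rightarrow> bool" where
  "cong_mod S x y \<longleftrightarrow> x - y \<in> spans S"

lemma equivp_cong_mod: "equivp (cong_mod S)"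
proof (rule equivpI)
  show "reflp (cong_mod S)"
    by (rule reflpI) (simp add: cong_mod_def spans_zero)
  show "symp (cong_mod S)"
    by (rule sympI) (metis cong_mod_def minus_diff_eq spans_uminus)
  show "transp (cong_mod S)"
  proof (rule transpI)
    fix x y z assume "cong_mod S x y" "cong_mod S y z"
    then have "(x - y) + (y - z) \<in> spans S"
      unfolding cong_mod_def by (rule spans_add)
    then show "cong_mod S x z" by (simp add: cong_mod_def)
  qed
qed

lemma cong_mod_refl: "cong_mod S x x"
  by (simp add: cong_mod_def spans_zero)

lemma cong_mod_add:
  assumes "cong_mod S x x'" "cong_mod S y y'"
  shows "cong_mod S (x + y) (x' + y')"
  using spans_add[OF assms[unfolded cong_mod_def]]
  by (simp only: cong_mod_def add_diff_add)

lemma cong_mod_uminus: "cong_mod S x x' \<Longrightarrow> cong_mod S (- x) (- x')"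
  using spans_uminus[of "x - x'" S] by (simp add: cong_mod_def minus_diff_commute)

lemma cong_mod_diff:
  "cong_mod S x x' \<Longrightarrow> cong_mod S y y' \<Longrightarrow> cong_mod S (x - y) (x' - y')"
  using cong_mod_add[of S x x' "- y" "- y'"] cong_mod_uminus[of S y y'] by simp

lemma fscale_diff: "fscale c (x - y) = fscale c x - fscale c y"
  by (rule poly_mapping_eqI) (simp add: lookup_minus algebra_simps)

lemma cong_mod_fscale: "cong_mod S x x' \<Longrightarrow> cong_mod S (fscale c x) (fscale c x')"
  using spans_scale[of "x - x'" S c] by (simp add: cong_mod_def fscale_diff)

text \<open>\<open>\<Omega>\<^sup>1(R)\<close>: the generator \<open>a\<close> stands for \<open>da\<close>.\<close>

definition kaehler_rels :: "('r::complex_comm_algebra \<Rightarrow>\<^sub>0 'r) set" where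
  "kaehler_rels =
     {gen (a + b) - gen a - gen b | a b. True}
   \<union> {gen (scaleC z a) - fscale (scaleC z 1) (gen a) | z a. True}
   \<union> {gen (a * b) - fscale b (gen a) - fscale a (gen b) | a b. True}"

quotient_type (overloaded) 'r kaehler =
  "'r::complex_comm_algebra \<Rightarrow>\<^sub>0 'r" / "cong_mod kaehler_rels"
  by (rule equivp_cong_mod)

instantiation kaehler :: (complex_comm_algebra) ab_group_add
begin
lift_definition zero_kaehler :: "'a kaehler" is "0" .
lift_definition plus_kaehler :: "'a kaehler \<Rightarrow> 'a kaehler \<Rightarrow> 'a kaehler" is "(+)"
  by (rule cong_mod_add)
lift_definition minus_kaehler :: "'a kaehler \<Rightarrow> 'a kaehler \<Rightarrow> 'a kaehler" is "(-)"
  by (rule cong_mod_diff)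
lift_definition uminus_kaehler :: "'a kaehler \<Rightarrow> 'a kaehler" is "uminus"
  by (rule cong_mod_uminus)
instance
proof
  fix a b c :: "'a kaehler"
  show "a + b + c = a + (b + c)"
    by (induct a rule: kaehler.abs_induct, induct b rule: kaehler.abs_induct, induct c rule: kaehler.abs_induct) (simp add: plus_kaehler.abs_eq algebra_simps)
  show "a + b = b + a"
    by (induct a rule: kaehler.abs_induct, induct b rule: kaehler.abs_induct) (simp add: plus_kaehler.abs_eq algebra_simps)
  show "0 + a = a"
    by (induct a rule: kaehler.abs_induct) (simp add: plus_kaehler.abs_eq zero_kaehler_def)
  show "- a + a = 0"
    by (induct a rule: kaehler.abs_induct) (simp add: plus_kaehler.abs_eq uminus_kaehler.abs_eq zero_kaehler_def)
  show "a - b = a + - b"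
    by (induct a rule: kaehler.abs_induct, induct b rule: kaehler.abs_induct)
      (simp add: plus_kaehler.abs_eq uminus_kaehler.abs_eq minus_kaehler.abs_eq)
qed
end

lift_definition kscale :: "'r::complex_comm_algebra \<Rightarrow> 'r kaehler \<Rightarrow> 'r kaehler" is fscale
  by (rule cong_mod_fscale)

lift_definition kd :: "'r::complex_comm_algebra \<Rightarrow> 'r kaehler" is gen .

text \<open>
  The exterior algebra of the \<open>R\<close>-module \<open>\<Omega>\<^sup>1(R)\<close>, that is, the
  direct sum of all \<open>\<Omega>\<^sup>k(R)\<close>: the generator \<open>[u\<^sub>1, \<dots>, u\<^sub>k]\<close>
  stands for \<open>u\<^sub>1 \<and> \<dots> \<and> u\<^sub>k\<close>.  All relations are homogeneous in the
  length of the lists, and \<open>\<Omega>\<^sup>k(R)\<close> is the part spanned by the lists of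
  length \<open>k\<close>.
\<close>

definition wedge_rels :: "('r::complex_comm_algebra kaehler list \<Rightarrow>\<^sub>0 'r) set" where
  "wedge_rels =
     {gen (us @ (u + v) # vs) - gen (us @ u # vs) - gen (us @ v # vs) | us u v vs. True}
   \<union> {gen (us @ kscale r u # vs) - fscale r (gen (us @ u # vs)) | us r u vs. True}
   \<union> {gen (us @ u # vs @ u # ws) | us u vs ws. True}"

quotient_type (overloaded) 'r forms =
  "'r::complex_comm_algebra kaehler list \<Rightarrow>\<^sub>0 'r" / "cong_mod wedge_rels"
  by (rule equivp_cong_mod)

instantiation forms :: (complex_comm_algebra) ab_group_add
begin
lift_definition zero_forms :: "'a forms" is "0" .
lift_definition plus_forms :: "'a forms \<Rightarrow> 'a forms \<Rightarrow> 'a forms" is "(+)"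
  by (rule cong_mod_add)
lift_definition minus_forms :: "'a forms \<Rightarrow> 'a forms \<Rightarrow> 'a forms" is "(-)"
  by (rule cong_mod_diff)
lift_definition uminus_forms :: "'a forms \<Rightarrow> 'a forms" is "uminus"
  by (rule cong_mod_uminus)
instance
proof
  fix a b c :: "'a forms"
  show "a + b + c = a + (b + c)"
    by (induct a rule: forms.abs_induct, induct b rule: forms.abs_induct, induct c rule: forms.abs_induct) (simp add: plus_forms.abs_eq algebra_simps)
  show "a + b = b + a"
    by (induct a rule: forms.abs_induct, induct b rule: forms.abs_induct) (simp add: plus_forms.abs_eq algebra_simps)
  show "0 + a = a"
    by (induct a rule: forms.abs_induct) (simp add: plus_forms.abs_eq zero_forms_def)
  show "- a + a = 0"
    by (induct a rule: forms.abs_induct) (simp add: plus_forms.abs_eq uminus_forms.abs_eq zero_forms_def)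
  show "a - b = a + - b"
    by (induct a rule: forms.abs_induct, induct b rule: forms.abs_induct)
      (simp add: plus_forms.abs_eq uminus_forms.abs_eq minus_forms.abs_eq)
qed
end

lift_definition form_scale :: "'r::complex_comm_algebra \<Rightarrow> 'r forms \<Rightarrow> 'r forms" is fscale
  by (rule cong_mod_fscale)

definition wedge :: "'r::complex_comm_algebra kaehler list \<Rightarrow> 'r forms" where
  "wedge us = abs_forms (gen us)"

text \<open>
  \<open>M \<otimes>\<^sub>R \<Omega>(R)\<close> for a Poisson module \<open>M\<close> whose underlying
  \<open>R\<close>-module is \<open>R\<close> with the usual product: the free abelian group on
  pairs \<open>(m, w)\<close> modulo the subgroup of the usual relations.  It is the direct sum
  of the \<open>M \<otimes>\<^sub>R \<Omega>\<^sup>k(R)\<close>.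
\<close>

definition tensor_rels :: "('r::complex_comm_algebra \<times> 'r forms \<Rightarrow>\<^sub>0 int) set" where
  "tensor_rels =
     {gen (m + m', w) - gen (m, w) - gen (m', w) | m m' w. True}
   \<union> {gen (m, w + w') - gen (m, w) - gen (m, w') | m w w'. True}
   \<union> {gen (m * r, w) - gen (m, form_scale r w) | m r w. True}"

quotient_type (overloaded) 'r mforms =
  "'r::complex_comm_algebra \<times> 'r forms \<Rightarrow>\<^sub>0 int" / "cong_mod tensor_rels"
  by (rule equivp_cong_mod)

instantiation mforms :: (complex_comm_algebra) ab_group_add
begin
lift_definition zero_mforms :: "'a mforms" is "0" .
lift_definition plus_mforms :: "'a mforms \<Rightarrow> 'a mforms \<Rightarrow> 'a mforms" is "(+)"
  by (rule cong_mod_add)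
lift_definition minus_mforms :: "'a mforms \<Rightarrow> 'a mforms \<Rightarrow> 'a mforms" is "(-)"
  by (rule cong_mod_diff)
lift_definition uminus_mforms :: "'a mforms \<Rightarrow> 'a mforms" is "uminus"
  by (rule cong_mod_uminus)
instance
proof
  fix a b c :: "'a mforms"
  show "a + b + c = a + (b + c)"
    by (induct a rule: mforms.abs_induct, induct b rule: mforms.abs_induct, induct c rule: mforms.abs_induct) (simp add: plus_mforms.abs_eq algebra_simps)
  show "a + b = b + a"
    by (induct a rule: mforms.abs_induct, induct b rule: mforms.abs_induct) (simp add: plus_mforms.abs_eq algebra_simps)
  show "0 + a = a"
    by (induct a rule: mforms.abs_induct) (simp add: plus_mforms.abs_eq zero_mforms_def)
  show "- a + a = 0"
    by (induct a rule: mforms.abs_induct) (simp add: plus_mforms.abs_eq uminus_mforms.abs_eq zero_mforms_def)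
  show "a - b = a + - b"
    by (induct a rule: mforms.abs_induct, induct b rule: mforms.abs_induct)
      (simp add: plus_mforms.abs_eq uminus_mforms.abs_eq minus_mforms.abs_eq)
qed
end

lift_definition zscale :: "int \<Rightarrow> 'r::complex_comm_algebra mforms \<Rightarrow> 'r mforms" is fscale
  by (rule cong_mod_fscale)

definition tensor ::
    "'r::complex_comm_algebra \<Rightarrow> 'r forms \<Rightarrow> 'r mforms" (infixr \<open>\<otimes>\<^sub>R\<close> 70) where
  "m \<otimes>\<^sub>R w = abs_mforms (gen (m, w))"


section \<open>The boundary and coboundary operators\<close>

definition omit :: "nat \<Rightarrow> 'a list \<Rightarrow> 'a list" where
  "omit i xs = take i xs @ drop (Suc i) xs"

text \<open>
  List positions start at 0, so the sign \<open>(-1)\<^sup>i\<^sup>+\<^sup>1\<close> of the first sum of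
  \<open>\<partial>\<^sub>k\<close> becomes \<open>(-1)\<^sup>i\<close>, while \<open>(-1)\<^sup>i\<^sup>+\<^sup>j\<close>
  is unaffected by shifting both indices.
\<close>

definition boundary_formula ::
    "('r::complex_comm_algebra \<Rightarrow> 'r \<Rightarrow> 'r) \<Rightarrow> ('r \<Rightarrow> 'r \<Rightarrow> 'r)
      \<Rightarrow> 'r \<Rightarrow> 'r list \<Rightarrow> 'r mforms" where
  "boundary_formula br brM m as =
     (\<Sum>i<length as.
        zscale ((-1) ^ i) (brM m (as ! i) \<otimes>\<^sub>R wedge (map kd (omit i as))))
   + (\<Sum>j<length as. \<Sum>i<j.
        zscale ((-1) ^ (i + j))
          (m \<otimes>\<^sub>R wedge (map kd (br (as ! i) (as ! j) # omit i (omit j as)))))"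

text \<open>
  The direct sum of all \<open>\<partial>\<^sub>k\<close>.  The elements
  \<open>m \<otimes> da\<^sub>1 \<and> \<dots> \<and> da\<^sub>k\<close> generate the group, so
  the formula determines the operator.  For \<open>k = 0\<close> the formula gives \<open>0\<close>.
\<close>

definition boundary ::
    "('r::complex_comm_algebra \<Rightarrow> 'r \<Rightarrow> 'r) \<Rightarrow> ('r \<Rightarrow> 'r \<Rightarrow> 'r)
      \<Rightarrow> 'r mforms \<Rightarrow> 'r mforms" where
  "boundary br brM =
     (THE D. (\<forall>x y. D (x + y) = D x + D y) \<and>
             (\<forall>m as. D (m \<otimes>\<^sub>R wedge (map kd as)) = boundary_formula br brM m as))"

text \<open>
  \<open>\<chi>\<^sup>k(R)\<close>: a map \<open>R\<^sup>k \<rightarrow> R\<close> is a function on lists of length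
  \<open>k\<close>, extended by \<open>0\<close> to lists of any other length.
\<close>

definition multiderivs :: "nat \<Rightarrow> ('r::complex_comm_algebra list \<Rightarrow> 'r) set" where
  "multiderivs k = {P.
     (\<forall>fs. length fs \<noteq> k \<longrightarrow> P fs = 0) \<and>
     (\<forall>fs i j. length fs = k \<longrightarrow> i < k \<longrightarrow> j < k \<longrightarrow> i \<noteq> j \<longrightarrow>
        P (fs[i := fs ! j, j := fs ! i]) = - P fs) \<and>
     (\<forall>fs i. length fs = k \<longrightarrow> i < k \<longrightarrow>
        (\<forall>a b. P (fs[i := a + b]) = P (fs[i := a]) + P (fs[i := b])) \<and>
        (\<forall>z a. P (fs[i := scaleC z a]) = scaleC z (P (fs[i := a]))) \<and>
        (\<forall>a b. P (fs[i := a * b]) = a * P (fs[i := b]) + b * P (fs[i := a])))}"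

text \<open>
  For \<open>P \<in> \<chi>\<^sup>k(R)\<close> this is \<open>\<delta>\<^sub>k(P)\<close>; it vanishes on lists whose
  length is not \<open>k + 1\<close>.
\<close>

definition coboundary ::
    "('r::complex_comm_algebra \<Rightarrow> 'r \<Rightarrow> 'r) \<Rightarrow> ('r list \<Rightarrow> 'r) \<Rightarrow> 'r list \<Rightarrow> 'r" where
  "coboundary br P fs =
     (\<Sum>i<length fs. (-1) ^ i * br (fs ! i) (P (omit i fs)))
   + (\<Sum>j<length fs. \<Sum>i<j.
        (-1) ^ (i + j) * P (br (fs ! i) (fs ! j) # omit i (omit j fs)))"


section \<open>The map from multiderivations to forms\<close>

definition shuffles_perm :: "nat \<Rightarrow> nat \<Rightarrow> (nat \<Rightarrow> nat) set" where
  "shuffles_perm k n = {\<sigma>. \<sigma> permutes {1..n} \<and>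
     strict_mono_on {1..k} \<sigma> \<and> strict_mono_on {Suc k..n} \<sigma>}"

text \<open>
  \<open>\<iota>\<close> is a numbering of the variables by \<open>1, \<dots>, n\<close>, where \<open>n\<close> is the
  number of elements of \<open>'n\<close>, so that \<open>X (\<iota> i)\<close> is \<open>X\<^sub>i\<close>.
  For \<open>k = n + 1\<close> the target is in degree \<open>-1\<close>, hence zero.
\<close>

definition dag :: "(nat \<Rightarrow> 'n::finite) \<Rightarrow> nat \<Rightarrow> ('n cpoly list \<Rightarrow> 'n cpoly) \<Rightarrow> 'n cpoly mforms"
  where
  "dag \<iota> k P =
     (if k \<le> CARD('n) then
       (\<Sum>\<sigma>\<in>shuffles_perm k CARD('n).
          zscale (sign \<sigma>)
            (P (map (\<lambda>i. X (\<iota> (\<sigma> i))) [1..<Suc k])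
               \<otimes>\<^sub>R wedge (map (\<lambda>i. kd (X (\<iota> (\<sigma> i)))) [Suc k..<Suc CARD('n)])))
      else 0)"


section \<open>Existence of the Poisson structures on the polynomial ring\<close>

text \<open>
  For every skew-symmetric integer matrix there are a Poisson algebra and a Poisson module
  with the prescribed brackets; \<open>euler i\<close> is \<open>X\<^sub>i \<partial>/\<partial>X\<^sub>i\<close>.
\<close>

definition euler :: "'n \<Rightarrow> 'n cpoly \<Rightarrow> 'n cpoly" where
  "euler i f = Poly_Mapping.mapp (\<lambda>\<alpha> c. of_nat (Poly_Mapping.lookup \<alpha> i) * c) f"

definition log_br :: "int ^ 'n ^ 'n \<Rightarrow> 'n::finite cpoly \<Rightarrow> 'n cpoly \<Rightarrow> 'n cpoly" where
  "log_br A f g = (\<Sum>i\<in>UNIV. \<Sum>j\<in>UNIV. of_int (A $ i $ j) * euler i f * euler j g)"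

definition log_brM :: "int ^ 'n ^ 'n \<Rightarrow> 'n::finite cpoly \<Rightarrow> 'n cpoly \<Rightarrow> 'n cpoly" where
  "log_brM A m f =
     - log_br A f m + (\<Sum>i\<in>UNIV. of_int (\<Sum>l\<in>UNIV. A $ i $ l) * euler i f * m)"

lemma lookup_euler:
  "Poly_Mapping.lookup (euler i f) \<alpha> = of_nat (Poly_Mapping.lookup \<alpha> i) * Poly_Mapping.lookup f \<alpha>"
  by (simp add: euler_def lookup_mapp when_def in_keys_iff)

lemma euler_add: "euler i (f + g) = euler i f + euler i g"
  by (rule poly_mapping_eqI) (simp add: lookup_euler lookup_add distrib_left)

lemma euler_single:
  "euler i (Poly_Mapping.single \<alpha> u) = Poly_Mapping.single \<alpha> (of_nat (Poly_Mapping.lookup \<alpha> i) * u)"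
  by (rule poly_mapping_eqI) (simp add: lookup_euler lookup_single when_def)

lemma scaleC_conv: "scaleC c (f :: 'n cpoly) = Poly_Mapping.single 0 c * f"
  by (simp add: scaleC_poly_mapping_conv scaleC_complex_def)

lemma of_int_conv: "(of_int z :: 'n cpoly) = Poly_Mapping.single 0 (of_int z)"
  by simp

lemma single_sum':
  "(\<Sum>i\<in>S. Poly_Mapping.single \<alpha> (u i)) = Poly_Mapping.single \<alpha> (\<Sum>i\<in>S. u i :: complex)"
  by (induct S rule: infinite_finite_induct) (simp_all add: single_add)

lemma euler_scale: "euler i (scaleC c f) = scaleC c (euler i f)"
  by (rule poly_mapping_eqI)
    (simp add: lookup_euler scaleC_poly_mapping_def scaleC_complex_def)

definition pair :: "int ^ 'n ^ 'n \<Rightarrow> ('n::finite \<Rightarrow>\<^sub>0 nat) \<Rightarrow> ('n \<Rightarrow>\<^sub>0 nat) \<Rightarrow> complex" where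
  "pair A \<alpha> \<beta> = (\<Sum>i\<in>UNIV. \<Sum>j\<in>UNIV. of_int (A $ i $ j)
      * of_nat (Poly_Mapping.lookup \<alpha> i) * of_nat (Poly_Mapping.lookup \<beta> j))"

definition pair1 :: "int ^ 'n ^ 'n \<Rightarrow> ('n::finite \<Rightarrow>\<^sub>0 nat) \<Rightarrow> complex" where
  "pair1 A \<alpha> = (\<Sum>i\<in>UNIV. of_int (\<Sum>l\<in>UNIV. A $ i $ l) * of_nat (Poly_Mapping.lookup \<alpha> i))"

lemma pair_add:
  "pair A (\<alpha> + \<beta>) \<gamma> = pair A \<alpha> \<gamma> + pair A \<beta> \<gamma>"
  "pair A \<alpha> (\<beta> + \<gamma>) = pair A \<alpha> \<beta> + pair A \<alpha> \<gamma>"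
  "pair1 A (\<alpha> + \<beta>) = pair1 A \<alpha> + pair1 A \<beta>"
  by (simp_all add: pair_def pair1_def lookup_add distrib_left distrib_right sum.distrib
      del: of_int_sum)

lemma pair_skew:
  assumes "Finite_Cartesian_Product.transpose A = - A"
  shows "pair A \<beta> \<alpha> = - pair A \<alpha> \<beta>"
proof -
  have *: "A $ j $ i = - A $ i $ j" for i j
    using assms by (metis (no_types, lifting) Finite_Cartesian_Product.transpose_def
        vec_lambda_beta vector_uminus_component)
  have "pair A \<beta> \<alpha> = (\<Sum>j\<in>UNIV. \<Sum>i\<in>UNIV. of_int (A $ i $ j)
      * of_nat (Poly_Mapping.lookup \<beta> i) * of_nat (Poly_Mapping.lookup \<alpha> j))"
    unfolding pair_def by (rule sum.swap)
  also have "\<dots> = - pair A \<alpha> \<beta>"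
    unfolding pair_def sum_negf[symmetric]
    by (intro sum.cong refl) (subst *, simp)
  finally show ?thesis .
qed

lemma log_br_single:
  "log_br A (Poly_Mapping.single \<alpha> u) (Poly_Mapping.single \<beta> v)
     = Poly_Mapping.single (\<alpha> + \<beta>) (pair A \<alpha> \<beta> * u * v)"
  by (simp add: log_br_def euler_single of_int_conv mult_single single_sum' pair_def
      sum_distrib_left sum_distrib_right mult_ac add.commute[of \<beta> \<alpha>] del: single_of_int)

lemma log_brM_single:
  "log_brM A (Poly_Mapping.single \<alpha> u) (Poly_Mapping.single \<beta> v)
     = Poly_Mapping.single (\<alpha> + \<beta>) ((pair1 A \<beta> - pair A \<beta> \<alpha>) * u * v)"
  unfolding log_brM_def log_br_single
  by (simp add: euler_single of_int_conv mult_single single_sum' pair1_def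
      single_uminus[symmetric] single_add[symmetric] algebra_simps
      sum_distrib_left sum_distrib_right del: of_int_sum single_of_int)

lemma log_br_add:
  "log_br A (f + g) h = log_br A f h + log_br A g h"
  "log_br A f (g + h) = log_br A f g + log_br A f h"
  by (simp_all add: log_br_def euler_add distrib_left distrib_right sum.distrib)

lemma log_br_scale:
  "log_br A (scaleC c f) h = scaleC c (log_br A f h)"
  "log_br A f (scaleC c h) = scaleC c (log_br A f h)"
  by (simp_all only: log_br_def euler_scale) (simp_all add: scaleC_conv sum_distrib_left mult_ac)

lemma log_brM_add:
  "log_brM A (f + g) h = log_brM A f h + log_brM A g h"
  "log_brM A f (g + h) = log_brM A f g + log_brM A f h"
  by (simp_all add: log_brM_def log_br_add euler_add distrib_left distrib_right sum.distrib)

lemma log_brM_scale: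
  "log_brM A (scaleC c f) h = scaleC c (log_brM A f h)"
  "log_brM A f (scaleC c h) = scaleC c (log_brM A f h)"
  by (simp_all only: log_brM_def log_br_scale euler_scale)
    (simp_all add: scaleC_conv sum_distrib_left algebra_simps)

lemma cpoly_induct [case_names single add]:
  assumes "\<And>\<alpha> u. Q (Poly_Mapping.single \<alpha> u)" "\<And>f g. Q f \<Longrightarrow> Q g \<Longrightarrow> Q (f + g)"
  shows "Q (f :: 'n cpoly)"
proof (induct f rule: update_induct)
  case const
  show ?case using assms(1)[of 0 0] by simp
next
  case (update f a b)
  have "Poly_Mapping.update a b f = Poly_Mapping.single a b + f"
    using update(1) by (intro poly_mapping_eqI)
      (auto simp: lookup_update lookup_add lookup_single when_def in_keys_iff)
  then show ?case using assms update by simp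
qed

lemma single_sum_zero:
  "\<alpha> = \<beta> \<Longrightarrow> \<beta> = \<gamma> \<Longrightarrow> u + v + w = 0 \<Longrightarrow>
   Poly_Mapping.single \<alpha> u + Poly_Mapping.single \<beta> v + Poly_Mapping.single \<gamma> w = (0 :: 'n cpoly)"
  by (simp add: single_add[symmetric])

lemma sum3_zero:
  fixes x :: "'a::ab_group_add"
  assumes "x + y + z = 0" "x' + y' + z' = 0"
  shows "(x + x') + (y + y') + (z + z') = 0"
proof -
  have "(x + x') + (y + y') + (z + z') = (x + y + z) + (x' + y' + z')"
    by (simp only: add_ac)
  then show ?thesis by (simp only: assms add_0)
qed

lemma poisson_log_br:
  assumes A: "Finite_Cartesian_Product.transpose A = - A"
  shows "poisson_algebra (log_br A)"
proof
  note skew = pair_skew[OF A]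
  fix a b c :: "'a cpoly" and z
  show "log_br A (a + b) c = log_br A a c + log_br A b c" by (rule log_br_add)
  show "log_br A a (b + c) = log_br A a b + log_br A a c" by (rule log_br_add)
  show "log_br A (scaleC z a) c = scaleC z (log_br A a c)" by (rule log_br_scale)
  show "log_br A a (scaleC z b) = scaleC z (log_br A a b)" by (rule log_br_scale)
  have sk: "log_br A a b = - log_br A b a" for a b
  proof (induct a rule: cpoly_induct)
    case (single \<alpha> u)
    show ?case
    proof (induct b rule: cpoly_induct)
      case (single \<beta> v)
      show ?case
        unfolding log_br_single single_uminus
        by (subst skew) (simp add: add.commute mult_ac single_uminus[symmetric])
    qed (simp add: log_br_add)
  qed (simp add: log_br_add)
  show "log_br A a a = 0"
  proof -
    have "log_br A a a + log_br A a a = 0" by (subst sk) simp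
    then have "Poly_Mapping.lookup (log_br A a a) \<gamma> + Poly_Mapping.lookup (log_br A a a) \<gamma> = 0" for \<gamma>
      by (metis lookup_add lookup_zero)
    then show ?thesis by (intro poly_mapping_eqI) (simp add: mult_2[symmetric])
  qed
  show "log_br A a (b * c) = log_br A a b * c + b * log_br A a c"
  proof (induct a rule: cpoly_induct)
    case (single \<alpha> u)
    show ?case
    proof (induct b rule: cpoly_induct)
      case (single \<beta> v)
      show ?case
      proof (induct c rule: cpoly_induct)
        case (single \<gamma> w)
        show ?case
          by (simp add: log_br_single mult_single pair_add single_add[symmetric] algebra_simps)
      qed (simp add: log_br_add algebra_simps)
    qed (simp add: log_br_add algebra_simps)
  qed (simp add: log_br_add algebra_simps)
  show "log_br A a (log_br A b c) + log_br A b (log_br A c a) + log_br A c (log_br A a b) = 0"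
  proof (induct a rule: cpoly_induct)
    case (single \<alpha> u)
    show ?case
    proof (induct b rule: cpoly_induct)
      case (single \<beta> v)
      show ?case
      proof (induct c rule: cpoly_induct)
        case (single \<gamma> w)
        show ?case
          unfolding log_br_single pair_add
          by (rule single_sum_zero)
            (simp_all add: add_ac skew[of \<gamma> \<alpha>] skew[of \<beta> \<alpha>] skew[of \<gamma> \<beta>] algebra_simps)
      next
        case (add f g)
        show ?case unfolding log_br_add by (rule sum3_zero[OF add])
      qed
    next
      case (add f g)
      show ?case unfolding log_br_add by (rule sum3_zero[OF add])
    qed
  next
    case (add f g)
    show ?case unfolding log_br_add by (rule sum3_zero[OF add])
  qed
qed

lemma log_brM_rel:
  assumes A: "Finite_Cartesian_Product.transpose A = - A"
  shows "log_brM A x (log_br A a b) = log_brM A (log_brM A x a) b - log_brM A (log_brM A x b) a"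
    and "x * log_br A a b = log_brM A x a * b - log_brM A (x * b) a"
    and "log_brM A x (a * b) = log_brM A x a * b + log_brM A x b * a"
proof -
  note skew = pair_skew[OF A]
  show "log_brM A x (log_br A a b) = log_brM A (log_brM A x a) b - log_brM A (log_brM A x b) a"
  proof (induct x rule: cpoly_induct)
    case (single \<alpha> u)
    show ?case
    proof (induct a rule: cpoly_induct)
      case (single \<beta> v)
      show ?case
      proof (induct b rule: cpoly_induct)
        case (single \<gamma> w)
        have e: "\<alpha> + \<gamma> + \<beta> = \<alpha> + (\<beta> + \<gamma>)" "\<alpha> + \<beta> + \<gamma> = \<alpha> + (\<beta> + \<gamma>)" by (simp_all add: add_ac)
        show ?case
          unfolding log_br_single log_brM_single pair_add e single_diff[symmetric]
          by (intro arg_cong[where f = "Poly_Mapping.single (\<alpha> + (\<beta> + \<gamma>))"])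
            (simp add: skew[of \<gamma> \<beta>] algebra_simps)
      qed (simp add: log_br_add log_brM_add)
    qed (simp add: log_br_add log_brM_add)
  qed (simp add: log_br_add log_brM_add)
  show "x * log_br A a b = log_brM A x a * b - log_brM A (x * b) a"
  proof (induct x rule: cpoly_induct)
    case (single \<alpha> u)
    show ?case
    proof (induct a rule: cpoly_induct)
      case (single \<beta> v)
      show ?case
      proof (induct b rule: cpoly_induct)
        case (single \<gamma> w)
        have e: "\<alpha> + \<gamma> + \<beta> = \<alpha> + (\<beta> + \<gamma>)" "\<alpha> + \<beta> + \<gamma> = \<alpha> + (\<beta> + \<gamma>)" by (simp_all add: add_ac)
        show ?case
          unfolding log_br_single log_brM_single mult_single pair_add e single_diff[symmetric]
          by (intro arg_cong[where f = "Poly_Mapping.single (\<alpha> + (\<beta> + \<gamma>))"])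
            (simp add: algebra_simps)
      qed (simp add: log_br_add log_brM_add algebra_simps)
    qed (simp add: log_br_add log_brM_add algebra_simps)
  qed (simp add: log_br_add log_brM_add algebra_simps)
  show "log_brM A x (a * b) = log_brM A x a * b + log_brM A x b * a"
  proof (induct x rule: cpoly_induct)
    case (single \<alpha> u)
    show ?case
    proof (induct a rule: cpoly_induct)
      case (single \<beta> v)
      show ?case
      proof (induct b rule: cpoly_induct)
        case (single \<gamma> w)
        have e: "\<alpha> + \<gamma> + \<beta> = \<alpha> + (\<beta> + \<gamma>)" "\<alpha> + \<beta> + \<gamma> = \<alpha> + (\<beta> + \<gamma>)" by (simp_all add: add_ac)
        show ?case
          unfolding log_br_single log_brM_single mult_single pair_add e single_add[symmetric]
          by (intro arg_cong[where f = "Poly_Mapping.single (\<alpha> + (\<beta> + \<gamma>))"])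
            (simp add: algebra_simps)
      qed (simp add: log_br_add log_brM_add algebra_simps)
    qed (simp add: log_br_add log_brM_add algebra_simps)
  qed (simp add: log_br_add log_brM_add algebra_simps)
qed

lemma euler_X: "euler i (X j) = (if i = j then X j else 0)"
  by (simp add: X_def euler_single lookup_single when_def)

lemma log_br_X: "log_br A (X i) (X j) = of_int (A $ i $ j) * X i * X j"
  by (simp add: log_br_def euler_X if_distrib[of "\<lambda>x. _ * x * _"] if_distrib[of "\<lambda>x. _ * x"]
      cong: if_cong) (simp add: sum.delta if_distrib[of "\<lambda>x. x * _"] cong: if_cong)

lemma log_brM_X:
  "log_brM A m (X i) = - log_br A (X i) m + of_int (\<Sum>l\<in>UNIV. A $ i $ l) * X i * m"
proof -
  have "of_int (\<Sum>l\<in>UNIV. A $ j $ l) * euler j (X i) * m =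
    (if j = i then of_int (\<Sum>l\<in>UNIV. A $ i $ l) * X i * m else 0)" for j
    by (simp add: euler_X)
  then show ?thesis by (simp add: log_brM_def sum.delta)
qed

lemma poisson_structures_exist:
  fixes A :: "int ^ 'n ^ 'n::finite"
  assumes A: "Finite_Cartesian_Product.transpose A = - A"
  shows "\<exists>br brM. poisson_algebra br
    \<and> (\<forall>i j. br (X i) (X j) = of_int (A $ i $ j) * X i * X j)
    \<and> poisson_module br (*) brM
    \<and> (\<forall>m i. brM m (X i) = - br (X i) m + of_int (\<Sum>l\<in>UNIV. A $ i $ l) * X i * m)"
proof (intro exI conjI allI)
  show "poisson_algebra (log_br A)" by (rule poisson_log_br[OF A])
  then interpret poisson_algebra "log_br A" .
  show "poisson_module (log_br A) (*) (log_brM A)"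
    by standard (simp_all only: log_brM_add log_brM_scale log_brM_rel(1)[OF A] log_brM_rel(3)[OF A]
        distrib_left distrib_right scaleC_mult_left mult_1_right mult.assoc,
        simp_all add: log_brM_rel(2)[OF A] scaleC_conv mult_ac)
qed (rule log_br_X log_brM_X)+

end

theory Submission
  imports Defs
begin

text \<open>
  Both sides are sums over pairs of a \<open>k\<close>-subset \<open>S\<close> of the variables and a variable
  \<open>t\<close> outside \<open>S\<close>.  The sign of a shuffle depends only on the sum of the elements of
  the subset it selects.  Because \<open>{X\<^sub>i, X\<^sub>j}\<close> is a multiple of \<open>X\<^sub>i X\<^sub>j\<close>, the Leibniz rule
  collapses the double sums in \<open>\<delta>\<close> and \<open>\<partial>\<close>, and with \<open>x\<close> the value of \<open>P\<close> on
  \<open>S\<close> the terms of the pair become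
  \<open>\<plusminus>({X\<^sub>t, x} - (\<Sum>s\<in>S. a\<^sub>t\<^sub>s) X\<^sub>t x)\<close> on the left and
  \<open>\<plusminus>({x, X\<^sub>t}\<^sub>M - (\<Sum>l\<notin>S. a\<^sub>t\<^sub>l) X\<^sub>t x)\<close> on the right.  These are opposite: in \<open>{x, X\<^sub>t}\<^sub>M\<close> the
  sum over all \<open>l\<close> turns minus the sum over \<open>l \<notin> S\<close> into the sum over \<open>S\<close>.

  The existence of \<open>\<partial>\<close> needs the formula to be an alternating multiderivation.  This
  follows by induction from Cartan's recursion
  \<open>\<partial>(m \<otimes> da \<and> \<omega>) = L\<^sub>a(m \<otimes> \<omega>) - da \<and> \<partial>(m \<otimes> \<omega>)\<close>.
\<close>

section \<open>Lifting maps to the quotients\<close>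

text \<open>The coefficient is an argument of \<open>g\<close> because the target is only an
  additive group. In the lifts below it is absorbed into the factor \<open>m\<close>, or, for
  integer coefficients, acts by \<open>zscale\<close>.\<close>

definition lin_ext :: "('x \<Rightarrow> 'c \<Rightarrow> 'b) \<Rightarrow> ('x \<Rightarrow>\<^sub>0 'c::zero) \<Rightarrow> 'b::comm_monoid_add" where
  "lin_ext g f = (\<Sum>x\<in>Poly_Mapping.keys f. g x (Poly_Mapping.lookup f x))"

context
  fixes g :: "'x \<Rightarrow> 'c::comm_ring_1 \<Rightarrow> 'b::ab_group_add"
  assumes g_add: "\<And>x c d. g x (c + d) = g x c + g x d"
begin

lemma lin_ext_zero_coeff: "g x 0 = 0"
  using g_add[of x 0 0] by simp

lemma lin_ext_superset:
  assumes "finite S" "Poly_Mapping.keys f \<subseteq> S"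
  shows "lin_ext g f = (\<Sum>x\<in>S. g x (Poly_Mapping.lookup f x))"
  unfolding lin_ext_def by (rule sum.mono_neutral_left) (use assms in \<open>auto simp: in_keys_iff lin_ext_zero_coeff\<close>)

lemma lin_ext_add: "lin_ext g (f + h) = lin_ext g f + lin_ext g h"
proof -
  let ?S = "Poly_Mapping.keys f \<union> Poly_Mapping.keys h"
  have "Poly_Mapping.keys (f + h) \<subseteq> ?S" by (rule keys_add)
  then show ?thesis
    by (simp add: lin_ext_superset[of ?S] lookup_add g_add sum.distrib)
qed

lemma lin_ext_single: "lin_ext g (Poly_Mapping.single x c) = g x c"
  by (subst lin_ext_superset[of "{x}"]) auto

lemma lin_ext_diff: "lin_ext g (f - h) = lin_ext g f - lin_ext g h"
  using lin_ext_add[of "f - h" h] by simp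

lemma lin_ext_fscale: "lin_ext g (fscale c f) = lin_ext (\<lambda>x d. g x (c * d)) f"
proof -
  have "Poly_Mapping.keys (fscale c f) \<subseteq> Poly_Mapping.keys f"
    by (auto simp: in_keys_iff)
  then show ?thesis
    by (subst lin_ext_superset[of "Poly_Mapping.keys f"]) (auto simp: lin_ext_def)
qed

end

lemma free_module_induct [case_names single add]:
  assumes "\<And>x c. Q (Poly_Mapping.single x c)" "\<And>f g. Q f \<Longrightarrow> Q g \<Longrightarrow> Q (f + g)"
  shows "Q (f :: 'x \<Rightarrow>\<^sub>0 'c::comm_ring_1)"
proof (induct f rule: update_induct)
  case const
  show ?case using assms(1)[of undefined 0] by simp
next
  case (update f a b)
  have "Poly_Mapping.update a b f = Poly_Mapping.single a b + f"
    using update(1) by (intro poly_mapping_eqI)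
      (auto simp: lookup_update lookup_add lookup_single when_def in_keys_iff)
  then show ?case using assms update by simp
qed

lemma fscale_single [simp]: "fscale c (Poly_Mapping.single x d) = Poly_Mapping.single x (c * d)"
  by (rule poly_mapping_eqI) (simp add: lookup_single when_def)

lemma cong_mod_rel: "x - y \<in> S \<Longrightarrow> cong_mod S x y"
  unfolding cong_mod_def spans_def by (rule module.span_base[OF module_fscale])

lemma spans_induct [consumes 1, case_names base zero add scale]:
  assumes "f \<in> spans S" "\<And>f. f \<in> S \<Longrightarrow> Q f" "Q 0"
    "\<And>f g. Q f \<Longrightarrow> Q g \<Longrightarrow> Q (f + g)" "\<And>c f. Q f \<Longrightarrow> Q (fscale c f)"
  shows "Q f"
  using module.span_induct[OF module_fscale assms(1)[unfolded spans_def], of Q] assms(2-)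
  by (auto simp: module.subspace_def[OF module_fscale])

section \<open>Relations and induction principles in the three quotients\<close>

lemma kd_add: "kd (a + b) = kd a + kd b"
proof -
  have "gen (a + b) - gen a - gen b \<in> kaehler_rels" by (auto simp: kaehler_rels_def)
  then show ?thesis
    by (auto simp: kd_def plus_kaehler.abs_eq kaehler.abs_eq_iff diff_diff_add intro!: cong_mod_rel)
qed

lemma kd_scaleC: "kd (scaleC z a) = kscale (scaleC z 1) (kd a)"
proof -
  have "gen (scaleC z a) - fscale (scaleC z 1) (gen a) \<in> kaehler_rels"
    unfolding kaehler_rels_def by blast
  then show ?thesis
    by (simp only: kd_def kscale.abs_eq kaehler.abs_eq_iff id_apply map_fun_apply cong_mod_rel)
qed

lemma kd_mult: "kd (a * b) = kscale b (kd a) + kscale a (kd b)"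
proof -
  have "gen (a * b) - fscale b (gen a) - fscale a (gen b) \<in> kaehler_rels"
    unfolding kaehler_rels_def by blast
  then show ?thesis
    by (simp only: kd_def plus_kaehler.abs_eq kscale.abs_eq kaehler.abs_eq_iff id_apply map_fun_apply
        cong_mod_rel diff_diff_add)
qed

lemma kaehler_induct [case_names scale add]:
  assumes "\<And>r a. Q (kscale r (kd a))" "\<And>u v. Q u \<Longrightarrow> Q v \<Longrightarrow> Q (u + v)"
  shows "Q u"
proof (induct u rule: kaehler.abs_induct)
  case (1 f)
  show ?case
  proof (induct f rule: free_module_induct)
    case (single x c)
    then show ?case using assms(1)[of c x] by (simp add: kd_def kscale.abs_eq)
  next
    case (add f g)
    then show ?case using assms(2) by (simp add: plus_kaehler.abs_eq[symmetric])
  qed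
qed

lemma wedge_add: "wedge (us @ (u + v) # vs) = wedge (us @ u # vs) + wedge (us @ v # vs)"
proof -
  have "gen (us @ (u + v) # vs) - gen (us @ u # vs) - gen (us @ v # vs) \<in> wedge_rels"
    unfolding wedge_rels_def by blast
  then show ?thesis
    by (simp only: wedge_def plus_forms.abs_eq forms.abs_eq_iff cong_mod_rel diff_diff_add)
qed

lemma wedge_scale: "wedge (us @ kscale r u # vs) = form_scale r (wedge (us @ u # vs))"
proof -
  have "gen (us @ kscale r u # vs) - fscale r (gen (us @ u # vs)) \<in> wedge_rels"
    unfolding wedge_rels_def by blast
  then show ?thesis
    by (simp only: wedge_def form_scale.abs_eq forms.abs_eq_iff cong_mod_rel)
qed

lemma wedge_repeat: "wedge (us @ u # vs @ u # ws) = 0"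
proof -
  have "gen (us @ u # vs @ u # ws) - 0 \<in> (wedge_rels :: ('a kaehler list \<Rightarrow>\<^sub>0 'a) set)"
    unfolding wedge_rels_def by (simp only: diff_zero) blast
  then show ?thesis
    by (simp only: wedge_def zero_forms_def forms.abs_eq_iff cong_mod_rel)
qed

lemma tensor_add_left: "(m + m') \<otimes>\<^sub>R w = m \<otimes>\<^sub>R w + m' \<otimes>\<^sub>R w"
proof -
  have "gen (m + m', w) - gen (m, w) - gen (m', w) \<in> tensor_rels"
    unfolding tensor_rels_def by blast
  then show ?thesis
    by (simp only: tensor_def plus_mforms.abs_eq mforms.abs_eq_iff cong_mod_rel diff_diff_add)
qed

lemma tensor_add_right: "m \<otimes>\<^sub>R (w + w') = m \<otimes>\<^sub>R w + m \<otimes>\<^sub>R w'"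
proof -
  have "gen (m, w + w') - gen (m, w) - gen (m, w') \<in> tensor_rels"
    unfolding tensor_rels_def by blast
  then show ?thesis
    by (simp only: tensor_def plus_mforms.abs_eq mforms.abs_eq_iff cong_mod_rel diff_diff_add)
qed

lemma tensor_scale: "m \<otimes>\<^sub>R form_scale r w = (m * r) \<otimes>\<^sub>R w"
proof -
  have "gen (m * r, w) - gen (m, form_scale r w) \<in> tensor_rels"
    unfolding tensor_rels_def by blast
  then have "(m * r) \<otimes>\<^sub>R w = m \<otimes>\<^sub>R form_scale r w"
    by (simp only: tensor_def mforms.abs_eq_iff cong_mod_rel)
  then show ?thesis by simp
qed

lemma tensor_zero_left [simp]: "0 \<otimes>\<^sub>R w = 0"
  using tensor_add_left[of 0 0 w] by simp

lemma tensor_zero_right [simp]: "m \<otimes>\<^sub>R 0 = 0"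
  using tensor_add_right[of m 0 0] by simp

lemma tensor_minus_left: "(- m) \<otimes>\<^sub>R w = - (m \<otimes>\<^sub>R w)"
  using tensor_add_left[of m "- m" w] by (simp add: eq_neg_iff_add_eq_0 add.commute)

lemma zscale_add: "zscale c (x + y) = zscale c x + zscale c y"
  by (induct x rule: mforms.abs_induct, induct y rule: mforms.abs_induct)
    (simp add: plus_mforms.abs_eq zscale.abs_eq module.scale_right_distrib[OF module_fscale])

lemma zscale_add_left: "zscale (c + d) x = zscale c x + zscale d x"
  by (induct x rule: mforms.abs_induct)
    (simp add: plus_mforms.abs_eq zscale.abs_eq module.scale_left_distrib[OF module_fscale])

lemma zscale_one [simp]: "zscale 1 x = x"
  by (induct x rule: mforms.abs_induct)
    (simp add: zscale.abs_eq module.scale_one[OF module_fscale])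

lemma zscale_zscale: "zscale c (zscale d x) = zscale (c * d) x"
  by (induct x rule: mforms.abs_induct)
    (simp add: zscale.abs_eq module.scale_scale[OF module_fscale])

lemma zscale_zero [simp]: "zscale c 0 = 0"
  using zscale_add[of c 0 0] by simp

lemma zscale_zero_left [simp]: "zscale 0 x = 0"
  using zscale_add_left[of 0 0 x] by simp

lemma zscale_minus_left [simp]: "zscale (- c) x = - zscale c x"
  using zscale_add_left[of c "- c" x] by (simp add: eq_neg_iff_add_eq_0 add.commute)

lemma zscale_minus [simp]: "zscale c (- x) = - zscale c x"
  using zscale_add[of c x "- x"] by (simp add: eq_neg_iff_add_eq_0 add.commute)

lemma zscale_sum: "zscale c (sum f S) = (\<Sum>x\<in>S. zscale c (f x))"
  by (induct S rule: infinite_finite_induct) (simp_all add: zscale_add)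

lemma additive_zscale:
  assumes "Modules.additive D"
  shows "D (zscale c x) = zscale c (D x)"
proof (induct c rule: int_induct[where k = 0])
  case base
  show ?case using additive.zero[OF assms] by simp
next
  case (step1 i)
  then show ?case by (simp add: zscale_add_left additive.add[OF assms])
next
  case (step2 i)
  then show ?case
    by (simp only: zscale_add_left zscale_minus_left zscale_one diff_conv_add_uminus additive.add[OF assms] additive.minus[OF assms])
qed

text \<open>Scalars of forms cross the tensor sign into \<open>m\<close>. The remaining coefficients
  are integers, which sums and negatives of generators reach.\<close>

lemma mforms_gen_induct [case_names tensor add minus]:
  assumes "\<And>m us. Q (m \<otimes>\<^sub>R wedge us)" "\<And>x y. Q x \<Longrightarrow> Q y \<Longrightarrow> Q (x + y)"
    "\<And>x. Q x \<Longrightarrow> Q (- x)"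
  shows "Q x"
proof -
  have 0: "Q 0" using assms(1)[of 0 "[]"] by simp
  have 1: "Q (m \<otimes>\<^sub>R w)" for m w
  proof (induct w arbitrary: m rule: forms.abs_induct)
    case (1 f)
    show ?case
    proof (induct f rule: free_module_induct)
      case (single us r)
      then show ?case
        using assms(1)[of "m * r" us]
        by (simp add: tensor_scale[symmetric] wedge_def form_scale.abs_eq)
    next
      case (add f g)
      then show ?case using assms(2) by (simp add: plus_forms.abs_eq[symmetric] tensor_add_right)
    qed
  qed
  have 2: "Q (zscale c (m \<otimes>\<^sub>R w))" for c m w
  proof (induct c rule: int_induct[where k = 0])
    case base
    show ?case using 0 by simp
  next
    case (step1 i)
    then show ?case using assms(2) 1 by (simp add: zscale_add_left)
  next
    case (step2 i)
    then show ?case using assms(2)[OF step2(2) assms(3)[OF 1]] 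
      by (simp only: zscale_add_left zscale_minus_left zscale_one diff_conv_add_uminus)
  qed
  show ?thesis
  proof (induct x rule: mforms.abs_induct)
    case (1 f)
    show ?case
    proof (induct f rule: free_module_induct)
      case (single p c)
      then show ?case using 2[of c "fst p" "snd p"] by (simp add: tensor_def zscale.abs_eq)
    next
      case (add f g)
      then show ?case using assms(2) by (simp add: plus_mforms.abs_eq[symmetric])
    qed
  qed
qed

lemma mforms_induct [case_names tensor add minus]:
  assumes "\<And>m as. Q (m \<otimes>\<^sub>R wedge (map kd as))" "\<And>x y. Q x \<Longrightarrow> Q y \<Longrightarrow> Q (x + y)"
    "\<And>x. Q x \<Longrightarrow> Q (- x)"
  shows "Q x"
proof (induct x rule: mforms_gen_induct)
  case (tensor m us)
  \<comment> \<open>The entries are made exact from left to right. Each one-form is a sum of terms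
    \<open>r da\<close>, and \<open>r\<close> moves into \<open>m\<close>, so \<open>m\<close> and
    the exact prefix are generalised.\<close>
  have "Q (m \<otimes>\<^sub>R wedge (map kd as @ us))" for as
  proof (induct us arbitrary: m as)
    case Nil
    show ?case using assms(1)[of m as] by simp
  next
    case (Cons u us)
    show ?case
    proof (induct u arbitrary: m rule: kaehler_induct)
      case (scale r a)
      show ?case using Cons[of "m * r" "as @ [a]"] by (simp add: wedge_scale tensor_scale)
    next
      case (add u v)
      then show ?case using assms(2) by (simp add: wedge_add tensor_add_right)
    qed
  qed
  from this[of "[]"] show ?case by simp
qed (use assms in blast)+

lemma additive_mforms_eqI:
  assumes "Modules.additive D" "Modules.additive E"
    and "\<And>m us. D (m \<otimes>\<^sub>R wedge us) = E (m \<otimes>\<^sub>R wedge us)"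
  shows "D x = E x"
  by (induct x rule: mforms_gen_induct)
    (simp_all add: assms(3) additive.add[OF assms(1)] additive.add[OF assms(2)]
      additive.minus[OF assms(1)] additive.minus[OF assms(2)])

section \<open>Lifting a derivation to one-forms\<close>

definition klift ::
    "('r::complex_comm_algebra \<Rightarrow> 'r \<Rightarrow> 'b::ab_group_add) \<Rightarrow> 'r \<Rightarrow> 'r kaehler \<Rightarrow> 'b" where
  "klift g m u = lin_ext (\<lambda>a c. g (m * c) a) (rep_kaehler u)"

locale derivation_pairing =
  fixes g :: "'r::complex_comm_algebra \<Rightarrow> 'r \<Rightarrow> 'b::ab_group_add"
  assumes add_left: "g (m + m') a = g m a + g m' a"
    and add_right: "g m (a + b) = g m a + g m b"
    and scale_right: "g m (scaleC z a) = g (m * scaleC z 1) a"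
    and mult_right: "g m (a * b) = g (m * b) a + g (m * a) b"
begin

text \<open>The axioms \<open>add_right\<close>, \<open>scale_right\<close> and
  \<open>mult_right\<close> kill the three families of relations. Scaling a relation by
  \<open>c\<close> replaces \<open>m\<close> by \<open>m * c\<close>, hence \<open>m\<close> is
  arbitrary in the induction.\<close>

lemma ext_kaehler_rels:
  assumes "f \<in> spans kaehler_rels"
  shows "lin_ext (\<lambda>a c. g (m * c) a) f = 0"
  using assms
proof (induct f arbitrary: m rule: spans_induct)
  case (base f)
  have add: "g (m * (c + d)) a = g (m * c) a + g (m * d) a" for c d a
    by (simp add: distrib_left add_left)
  note lin_ext = lin_ext_diff[OF add] lin_ext_single[OF add] lin_ext_fscale[OF add]
  from base show ?case
    unfolding kaehler_rels_def
    by (elim UnE CollectE exE conjE)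
      (simp_all add: lin_ext add_right scale_right mult_right)
next
  case zero
  show ?case by (simp add: lin_ext_def)
next
  case (add f h)
  then show ?case by (subst lin_ext_add) (simp_all add: distrib_left add_left)
next
  case (scale c f)
  then show ?case
    using scale[of "m * c"] by (subst lin_ext_fscale) (simp_all add: distrib_left add_left mult.assoc)
qed

lemma klift_abs: "klift g m (abs_kaehler f) = lin_ext (\<lambda>a c. g (m * c) a) f"
proof -
  have "cong_mod kaehler_rels (rep_kaehler (abs_kaehler f)) f"
    using kaehler.abs_eq_iff Quotient3_abs_rep[OF Quotient3_kaehler] by blast
  then have "lin_ext (\<lambda>a c. g (m * c) a) (rep_kaehler (abs_kaehler f) - f) = 0"
    unfolding cong_mod_def by (rule ext_kaehler_rels)
  then show ?thesis
    by (subst (asm) lin_ext_diff) (simp_all add: klift_def distrib_left add_left)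
qed

lemma klift_kd: "klift g m (kd a) = g m a"
  unfolding kd_def by (simp add: klift_abs lin_ext_single distrib_left add_left)

lemma klift_add_form: "klift g m (u + v) = klift g m u + klift g m v"
  by (induct u rule: kaehler.abs_induct, induct v rule: kaehler.abs_induct)
    (simp add: plus_kaehler.abs_eq klift_abs lin_ext_add distrib_left add_left)

lemma klift_scale_form: "klift g m (kscale r u) = klift g (m * r) u"
  by (induct u rule: kaehler.abs_induct)
    (simp add: kscale.abs_eq klift_abs lin_ext_fscale distrib_left add_left mult.assoc)

end

text \<open>Read off from the fixed representative over which \<open>klift\<close> sums. This rule
  and the next two carry operations on the inner function through the recursion of
  \<open>kextend\<close>.\<close>

lemma klift_plus: "klift (\<lambda>m a. g m a + h m a) m u = klift g m u + klift h m u"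
  unfolding klift_def lin_ext_def by (simp add: sum.distrib)

lemma klift_mult: "klift (\<lambda>m a. g (m * r) a) m u = klift g (m * r) u"
  unfolding klift_def lin_ext_def by (simp add: mult_ac)

lemma klift_zero: "klift (\<lambda>m a. 0) m u = 0"
  unfolding klift_def lin_ext_def by simp

text \<open>The maps \<open>G m [a\<^sub>1, \<dots>, a\<^sub>k]\<close> that factor through
  \<open>m \<otimes> da\<^sub>1 \<and> \<dots> \<and> da\<^sub>k\<close>.\<close>

locale alternating_derivation =
  fixes G :: "'r::complex_comm_algebra \<Rightarrow> 'r list \<Rightarrow> 'b::ab_group_add"
  assumes add_left: "G (m + m') as = G m as + G m' as"
    and add_slot: "G m (as @ (a + b) # bs) = G m (as @ a # bs) + G m (as @ b # bs)"
    and scale_slot: "G m (as @ scaleC z a # bs) = G (m * scaleC z 1) (as @ a # bs)"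
    and mult_slot: "G m (as @ (a * b) # bs) = G (m * b) (as @ a # bs) + G (m * a) (as @ b # bs)"
    and repeat_slot: "G m (as @ a # a # bs) = 0"
begin

text \<open>Lets the inductions below peel off the first entry of a list, with \<open>G\<close>
  generalised.\<close>

lemma cons: "alternating_derivation (\<lambda>m as. G m (a # as))"
proof
  show "G (m + m') (a # as) = G m (a # as) + G m' (a # as)" for m m' as by (rule add_left)
qed (use add_slot[of _ "a # as" for as] scale_slot[of _ "a # as" for as]
      mult_slot[of _ "a # as" for as] repeat_slot[of _ "a # as" for as] in simp_all)

end

locale alternating_multilinear =
  fixes G :: "'r::complex_comm_algebra \<Rightarrow> 'r kaehler list \<Rightarrow> 'b::ab_group_add"
  assumes add_left: "G (m + m') us = G m us + G m' us"
    and add_slot: "G m (us @ (u + v) # vs) = G m (us @ u # vs) + G m (us @ v # vs)"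
    and scale_slot: "G m (us @ kscale r u # vs) = G (m * r) (us @ u # vs)"
    and repeat_slot: "G m (us @ u # u # vs) = 0"
begin

text \<open>Polarisation: expand the repeated entry \<open>u + v\<close>.\<close>

lemma swap_slot: "G m (us @ u # v # vs) = - G m (us @ v # u # vs)"
proof -
  have "0 = G m (us @ (u + v) # (u + v) # vs)" by (simp add: repeat_slot)
  also have "\<dots> = G m (us @ u # (u + v) # vs) + G m (us @ v # (u + v) # vs)"
    by (rule add_slot)
  also have "\<dots> = G m (us @ u # v # vs) + G m (us @ v # u # vs)"
    using add_slot[of m "us @ [u]" u v vs] add_slot[of m "us @ [v]" u v vs]
    by (simp add: repeat_slot)
  finally show ?thesis by (simp add: eq_neg_iff_add_eq_0)
qed

text \<open>The relations of the exterior algebra allow equal entries at any distance. Adjacent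
  swaps bring them together.\<close>

lemma repeat_slots: "G m (us @ u # vs @ u # ws) = 0"
proof (induct vs arbitrary: us)
  case Nil
  show ?case using repeat_slot by simp
next
  case (Cons v vs)
  show ?case using Cons[of "us @ [v]"] swap_slot[of m us u v "vs @ u # ws"] by simp
qed

end

section \<open>Extension of alternating derivations to lists of one-forms\<close>

text \<open>A lift of all slots by currying: the first slot is lifted by \<open>klift\<close>,
  applied to the extension of \<open>G\<close> with its first entry frozen.\<close>

fun kextend :: "('r::complex_comm_algebra \<Rightarrow> 'r list \<Rightarrow> 'b::ab_group_add)
    \<Rightarrow> 'r \<Rightarrow> 'r kaehler list \<Rightarrow> 'b" where
  "kextend G m [] = G m []"
| "kextend G m (u # us) = klift (\<lambda>m a. kextend (\<lambda>m as. G m (a # as)) m us) m u"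

lemma kextend_plus: "kextend (\<lambda>m as. G m as + H m as) m us = kextend G m us + kextend H m us"
  by (induct us arbitrary: G H m) (simp_all add: klift_plus)

lemma kextend_mult: "kextend (\<lambda>m as. G (m * r) as) m us = kextend G (m * r) us"
proof (induct us arbitrary: G m)
  case (Cons u us)
  have "kextend (\<lambda>m as. G (m * r) (a # as)) m us = kextend (\<lambda>m as. G m (a # as)) (m * r) us" for m a
    by (rule Cons[of "\<lambda>m as. G m (a # as)"])
  then show ?case
    by (simp only: kextend.simps klift_mult[of "\<lambda>m a. kextend (\<lambda>m as. G m (a # as)) m us"])
qed simp

lemma kextend_zero: "kextend (\<lambda>m as. 0) m us = 0"
  by (induct us arbitrary: m) (simp_all add: klift_zero)

lemma kextend_plus_zero:
  assumes "\<And>m as. G m as + H m as = 0"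
  shows "kextend G m us + kextend H m us = 0"
  using kextend_plus[of G H m us] by (simp add: assms kextend_zero)

lemma kextend_add_left:
  assumes "\<And>m m' as. G (m + m') as = G m as + G m' as"
  shows "kextend G (m + m') us = kextend G m us + kextend G m' us"
  using assms
  by (induct us arbitrary: G m m') (simp_all add: klift_def lin_ext_def distrib_right sum.distrib)

context alternating_derivation
begin

lemma pairing: "derivation_pairing (\<lambda>m a. kextend (\<lambda>m as. G m (a # as)) m us)"
proof
  fix m m' a b z
  let ?g = "\<lambda>m a. kextend (\<lambda>m as. G m (a # as)) m us"
  show "?g (m + m') a = ?g m a + ?g m' a"
    by (rule kextend_add_left) (rule add_left)
  show "?g m (a + b) = ?g m a + ?g m b"
    by (simp add: kextend_plus[symmetric] add_slot[of _ "[]", simplified])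
  show "?g m (scaleC z a) = ?g (m * scaleC z 1) a"
    by (simp add: kextend_mult[symmetric] scale_slot[of _ "[]", simplified])
  show "?g m (a * b) = ?g (m * b) a + ?g (m * a) b"
    by (simp add: kextend_mult[symmetric] kextend_plus[symmetric] mult_slot[of _ "[]", simplified])
qed

lemma kextend_kd_Cons: "kextend G m (kd a # us) = kextend (\<lambda>m as. G m (a # as)) m us"
  by (simp add: derivation_pairing.klift_kd[OF pairing])

lemma kextend_kd: "kextend G m (map kd as) = G m as"
  using alternating_derivation_axioms
proof (induct as arbitrary: G m)
  case (Cons a as)
  interpret alternating_derivation G by (rule Cons(2))
  show ?case
    by (simp only: list.map kextend_kd_Cons Cons(1)[OF cons])
qed simp

lemma kextend_add_slot:
  "kextend G m (us @ (u + v) # vs) = kextend G m (us @ u # vs) + kextend G m (us @ v # vs)"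
  using alternating_derivation_axioms
proof (induct us arbitrary: G m)
  case Nil
  interpret alternating_derivation G by (rule Nil)
  show ?case by (simp add: derivation_pairing.klift_add_form[OF pairing])
next
  case (Cons w us)
  interpret alternating_derivation G by (rule Cons(2))
  show ?case by (simp add: Cons(1)[OF cons] klift_plus)
qed

lemma kextend_scale_slot:
  "kextend G m (us @ kscale r u # vs) = kextend G (m * r) (us @ u # vs)"
  using alternating_derivation_axioms
proof (induct us arbitrary: G m)
  case Nil
  interpret alternating_derivation G by (rule Nil)
  show ?case by (simp add: derivation_pairing.klift_scale_form[OF pairing])
next
  case (Cons w us)
  interpret alternating_derivation G by (rule Cons(2))
  show ?case
    by (simp add: Cons(1)[OF cons] klift_mult[of "\<lambda>m a. kextend (\<lambda>m as. G m (a # as)) m (us @ u # vs)"])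
qed

lemma kextend_swap_kd:
  "kextend G m (kd a # kd b # us) + kextend G m (kd b # kd a # us) = 0"
proof -
  interpret c: alternating_derivation "\<lambda>m as. G m (x # as)" for x by (rule cons)
  have eq: "kextend G m (kd a # kd b # us) = kextend (\<lambda>m as. G m (a # b # as)) m us" for a b
    by (simp only: kextend_kd_Cons c.kextend_kd_Cons)
  have zero: "G m (a # b # as) + G m (b # a # as) = 0" for m as
    using add_slot[of m "[]" a b "(a + b) # as"] repeat_slot[of m "[]"] 
      add_slot[of m "[a]" a b as] add_slot[of m "[b]" a b as] by simp
  show ?thesis unfolding eq by (rule kextend_plus_zero) (rule zero)
qed

text \<open>One-forms are sums of terms \<open>r da\<close>. Scalars move into \<open>m\<close>,
  where they commute, which leaves the exact case \<open>kextend_swap_kd\<close>.\<close>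

lemma kextend_swap: "kextend G m (u # v # us) + kextend G m (v # u # us) = 0"
proof -
  note sc = kextend_scale_slot[of _ "[]", unfolded append.simps] kextend_scale_slot[of _ "[w]" for w, unfolded append.simps]
  note ad = kextend_add_slot[of _ "[]", unfolded append.simps] kextend_add_slot[of _ "[w]" for w, unfolded append.simps]
  show ?thesis
  proof (induct u arbitrary: m v rule: kaehler_induct)
    case (scale r a)
    show ?case
    proof (induct v rule: kaehler_induct)
      case (scale s b)
      show ?case
        using kextend_swap_kd[of "m * r * s" a b] by (simp only: sc mult.assoc mult.commute[of s r])
    next
      case (add v w)
      then show ?case by (simp only: ad) (metis (no_types) add.assoc add.left_commute add.right_neutral)
    qed
  next
    case (add u w)
    from add[of m v] show ?case by (simp only: ad) (metis (no_types) add.assoc add.left_commute add.right_neutral)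
  qed
qed

lemma kextend_repeat: "kextend G m (u # u # us) = 0"
proof -
  note sc = kextend_scale_slot[of _ "[]", unfolded append.simps] kextend_scale_slot[of _ "[w]" for w, unfolded append.simps]
  note ad = kextend_add_slot[of _ "[]", unfolded append.simps] kextend_add_slot[of _ "[w]" for w, unfolded append.simps]
  interpret c: alternating_derivation "\<lambda>m as. G m (x # as)" for x by (rule cons)
  show ?thesis
  proof (induct u arbitrary: m rule: kaehler_induct)
    case (scale r a)
    have "kextend G m (kd a # kd a # us) = 0" for m
      by (simp only: kextend_kd_Cons c.kextend_kd_Cons kextend_zero
          repeat_slot[of _ "[]", unfolded append_Nil])
    then show ?case by (simp only: sc)
  next
    case (add u v)
    \<comment> \<open>A repeated sum \<open>u + v\<close> leaves the two cross terms, so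
      antisymmetry is needed before alternation.\<close>
    have "kextend G m (u # v # us) + kextend G m (v # u # us) = 0" by (rule kextend_swap)
    then show ?case using add[of m] by (simp only: ad) (simp add: add.commute del: kextend.simps)
  qed
qed

lemma kextend_repeat_slot: "kextend G m (us @ u # u # vs) = 0"
  using alternating_derivation_axioms
proof (induct us arbitrary: G m)
  case Nil
  interpret alternating_derivation G by (rule Nil)
  show ?case using kextend_repeat by simp
next
  case (Cons w us)
  interpret alternating_derivation G by (rule Cons(2))
  show ?case by (simp add: Cons(1)[OF cons] klift_zero)
qed

lemma alternating_multilinear_kextend: "alternating_multilinear (kextend G)"
  by standard (simp_all only: kextend_add_left[OF add_left] kextend_add_slot kextend_scale_slot
      kextend_repeat_slot)

end

section \<open>Descent to the exterior algebra and to the tensor product\<close>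

definition forms_lift ::
    "('r::complex_comm_algebra \<Rightarrow> 'r kaehler list \<Rightarrow> 'b::ab_group_add) \<Rightarrow> 'r \<Rightarrow> 'r forms \<Rightarrow> 'b" where
  "forms_lift G m w = lin_ext (\<lambda>us c. G (m * c) us) (rep_forms w)"

context alternating_multilinear
begin

lemma ext_wedge_rels:
  assumes "f \<in> spans wedge_rels"
  shows "lin_ext (\<lambda>us c. G (m * c) us) f = 0"
  using assms
proof (induct f arbitrary: m rule: spans_induct)
  case (base f)
  have add: "G (m * (c + d)) us = G (m * c) us + G (m * d) us" for c d us
    by (simp add: distrib_left add_left)
  note lin_ext = lin_ext_diff[OF add] lin_ext_single[OF add] lin_ext_fscale[OF add]
  from base show ?case
    unfolding wedge_rels_def
    by (elim UnE CollectE exE conjE)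
      (simp_all add: lin_ext add_slot scale_slot repeat_slots)
next
  case zero
  show ?case by (simp add: lin_ext_def)
next
  case (add f h)
  then show ?case by (subst lin_ext_add) (simp_all add: distrib_left add_left)
next
  case (scale c f)
  then show ?case
    using scale[of "m * c"] by (subst lin_ext_fscale) (simp_all add: distrib_left add_left mult.assoc)
qed

lemma forms_lift_abs: "forms_lift G m (abs_forms f) = lin_ext (\<lambda>us c. G (m * c) us) f"
proof -
  have "cong_mod wedge_rels (rep_forms (abs_forms f)) f"
    using forms.abs_eq_iff Quotient3_abs_rep[OF Quotient3_forms] by blast
  then have "lin_ext (\<lambda>us c. G (m * c) us) (rep_forms (abs_forms f) - f) = 0"
    unfolding cong_mod_def by (rule ext_wedge_rels)
  then show ?thesis
    by (subst (asm) lin_ext_diff) (simp_all add: forms_lift_def distrib_left add_left)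
qed

lemma forms_lift_wedge: "forms_lift G m (wedge us) = G m us"
  unfolding wedge_def by (simp add: forms_lift_abs lin_ext_single distrib_left add_left)

lemma forms_lift_add: "forms_lift G m (w + w') = forms_lift G m w + forms_lift G m w'"
  by (induct w rule: forms.abs_induct, induct w' rule: forms.abs_induct)
    (simp add: plus_forms.abs_eq forms_lift_abs lin_ext_add distrib_left add_left)

lemma forms_lift_scale: "forms_lift G m (form_scale r w) = forms_lift G (m * r) w"
  by (induct w rule: forms.abs_induct)
    (simp add: form_scale.abs_eq forms_lift_abs lin_ext_fscale distrib_left add_left mult.assoc)

lemma forms_lift_add_left: "forms_lift G (m + m') w = forms_lift G m w + forms_lift G m' w"
  unfolding forms_lift_def lin_ext_def by (simp add: distrib_right add_left sum.distrib)

end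

definition mforms_lift ::
    "('r::complex_comm_algebra \<Rightarrow> 'r kaehler list \<Rightarrow> 'r mforms) \<Rightarrow> 'r mforms \<Rightarrow> 'r mforms" where
  "mforms_lift G x = lin_ext (\<lambda>(m, w) c. zscale c (forms_lift G m w)) (rep_mforms x)"

text \<open>The universal property of the tensor product. The relation that moves a scalar across
  the tensor sign is respected by \<open>forms_lift_scale\<close>, the other two by additivity in
  each argument.\<close>

lemma alternating_multilinear_lift:
  fixes G :: "'r::complex_comm_algebra \<Rightarrow> 'r kaehler list \<Rightarrow> 'r mforms"
  assumes "alternating_multilinear G"
  shows additive_mforms_lift: "Modules.additive (mforms_lift G)"
    and mforms_lift_tensor: "mforms_lift G (m \<otimes>\<^sub>R wedge us) = G m us"
proof -
  interpret alternating_multilinear G by (rule assms)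
  let ?e = "\<lambda>(m, w) c. zscale c (forms_lift G m w)"
  have add: "?e p (c + d) = ?e p c + ?e p d" for p c d
    by (cases p) (simp add: zscale_add_left)
  note lin_ext = lin_ext_diff[OF add] lin_ext_single[OF add]
  have rels: "lin_ext ?e f = 0" if "f \<in> spans tensor_rels" for f
    using that
  proof (induct f rule: spans_induct)
    case (base f)
    then show ?case
      unfolding tensor_rels_def
      by (elim UnE CollectE exE conjE)
        (simp_all add: lin_ext forms_lift_add_left forms_lift_add forms_lift_scale zscale_add)
  next
    case zero
    show ?case by (simp add: lin_ext_def)
  next
    case (add f h)
    then show ?case by (simp add: lin_ext_add[OF \<open>\<And>d c p. ?e p (c + d) = ?e p c + ?e p d\<close>])
  next
    case (scale c f)
    have "lin_ext ?e (fscale c f) = zscale c (lin_ext ?e f)"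
      by (subst lin_ext_fscale[where g = ?e, OF add], unfold lin_ext_def)
         (simp add: zscale_sum zscale_zscale case_prod_unfold)
    then show ?case using scale by simp
  qed
  have abs: "mforms_lift G (abs_mforms f) = lin_ext ?e f" for f
  proof -
    have "cong_mod tensor_rels (rep_mforms (abs_mforms f)) f"
      using mforms.abs_eq_iff Quotient3_abs_rep[OF Quotient3_mforms] by blast
    then have "lin_ext ?e (rep_mforms (abs_mforms f) - f) = 0"
      unfolding cong_mod_def by (rule rels)
    then show ?thesis
      by (simp add: lin_ext mforms_lift_def)
  qed
  show "Modules.additive (mforms_lift G)"
  proof
    fix x y
    show "mforms_lift G (x + y) = mforms_lift G x + mforms_lift G y"
      by (induct x rule: mforms.abs_induct, induct y rule: mforms.abs_induct)
        (simp add: plus_mforms.abs_eq abs lin_ext_add[OF add])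
  qed
  show "mforms_lift G (m \<otimes>\<^sub>R wedge us) = G m us"
    by (simp add: tensor_def abs lin_ext forms_lift_wedge)
qed

section \<open>The boundary operator is well defined\<close>

lemma wedge_cons_add: "wedge ((u + v) # us) = wedge (u # us) + wedge (v # us)"
  using wedge_add[of "[]"] by simp

lemma wedge_cons_scale: "wedge (kscale r u # us) = form_scale r (wedge (u # us))"
  using wedge_scale[of "[]"] by simp

lemma wedge_repeat_adjacent: "wedge (us @ u # u # vs) = 0"
  using wedge_repeat[of us u "[]" vs] by simp

definition rmult :: "'r::complex_comm_algebra \<Rightarrow> 'r mforms \<Rightarrow> 'r mforms" where
  "rmult r = mforms_lift (\<lambda>m us. (m * r) \<otimes>\<^sub>R wedge us)"

definition wedge_left :: "'r::complex_comm_algebra kaehler \<Rightarrow> 'r mforms \<Rightarrow> 'r mforms" where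
  "wedge_left u = mforms_lift (\<lambda>m us. m \<otimes>\<^sub>R wedge (u # us))"

lemma alternating_multilinear_rmult: "alternating_multilinear (\<lambda>m us. (m * r) \<otimes>\<^sub>R wedge us)"
  by standard (simp_all add: tensor_add_left tensor_add_right distrib_right wedge_add wedge_scale
      tensor_scale wedge_repeat_adjacent mult.assoc mult.commute[of r])

lemma alternating_multilinear_wedge_left: "alternating_multilinear (\<lambda>m us. m \<otimes>\<^sub>R wedge (u # us))"
proof
  fix m m' r v w us vs
  show "(m + m') \<otimes>\<^sub>R wedge (u # us) = m \<otimes>\<^sub>R wedge (u # us) + m' \<otimes>\<^sub>R wedge (u # us)"
    by (rule tensor_add_left)
  show "m \<otimes>\<^sub>R wedge (u # us @ (v + w) # vs) = m \<otimes>\<^sub>R wedge (u # us @ v # vs) + m \<otimes>\<^sub>R wedge (u # us @ w # vs)"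
    using wedge_add[of "u # us"] by (simp add: tensor_add_right)
  show "m \<otimes>\<^sub>R wedge (u # us @ kscale r v # vs) = (m * r) \<otimes>\<^sub>R wedge (u # us @ v # vs)"
    using wedge_scale[of "u # us"] by (simp add: tensor_scale)
  show "m \<otimes>\<^sub>R wedge (u # us @ v # v # vs) = 0"
    using wedge_repeat_adjacent[of "u # us"] by simp
qed

interpretation rmult: Modules.additive "rmult r"
  unfolding rmult_def by (rule additive_mforms_lift[OF alternating_multilinear_rmult])

interpretation wedge_left: Modules.additive "wedge_left u"
  unfolding wedge_left_def by (rule additive_mforms_lift[OF alternating_multilinear_wedge_left])

lemma rmult_tensor [simp]: "rmult r (m \<otimes>\<^sub>R wedge us) = (m * r) \<otimes>\<^sub>R wedge us"
  unfolding rmult_def by (rule mforms_lift_tensor[OF alternating_multilinear_rmult])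

lemma wedge_left_tensor [simp]: "wedge_left u (m \<otimes>\<^sub>R wedge us) = m \<otimes>\<^sub>R wedge (u # us)"
  unfolding wedge_left_def by (rule mforms_lift_tensor[OF alternating_multilinear_wedge_left])

lemmas operator_additive = Modules.additive_def rmult.add wedge_left.add rmult.zero wedge_left.zero add_ac

lemma wedge_left_plus: "wedge_left (u + v) x = wedge_left u x + wedge_left v x"
  by (rule additive_mforms_eqI) (simp_all add: operator_additive wedge_cons_add tensor_add_right)

lemma wedge_left_kscale: "wedge_left (kscale r u) x = rmult r (wedge_left u x)"
  by (rule additive_mforms_eqI) (simp_all add: operator_additive wedge_cons_scale tensor_scale)

lemma wedge_left_rmult: "wedge_left u (rmult r x) = rmult r (wedge_left u x)"
  by (rule additive_mforms_eqI) (simp_all add: operator_additive)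

lemma wedge_left_repeat [simp]: "wedge_left u (wedge_left u x) = 0"
  by (rule additive_mforms_eqI)
    (simp_all add: operator_additive wedge_repeat_adjacent[of "[]", simplified])

lemma wedge_left_swap: "wedge_left u (wedge_left v x) = - wedge_left v (wedge_left u x)"
proof -
  have "wedge_left (u + v) (wedge_left (u + v) x) = 0" by simp
  then have "wedge_left v (wedge_left u x) + wedge_left u (wedge_left v x) = 0"
    by (simp only: wedge_left_plus wedge_left.add wedge_left_repeat) simp
  then show ?thesis by (simp add: eq_neg_iff_add_eq_0 add.commute)
qed

lemma rmult_left_commute: "rmult r (rmult s x) = rmult s (rmult r x)"
  by (rule additive_mforms_eqI) (simp_all add: operator_additive mult.assoc mult.commute[of r])

lemma tensor_mult_expand: "(m * r) \<otimes>\<^sub>R wedge us = rmult r (m \<otimes>\<^sub>R wedge us)"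
  by simp

lemma tensor_wedge_Cons: "m \<otimes>\<^sub>R wedge (u # us) = wedge_left u (m \<otimes>\<^sub>R wedge us)"
  by simp

lemma tensor_scale_slot: "m \<otimes>\<^sub>R wedge (us @ kscale r u # vs) = rmult r (m \<otimes>\<^sub>R wedge (us @ u # vs))"
  by (simp add: wedge_scale tensor_scale)

lemma tensor_diff_left: "(m - m') \<otimes>\<^sub>R w = m \<otimes>\<^sub>R w - m' \<otimes>\<^sub>R w"
  using tensor_add_left[of m "- m'" w] by (simp add: tensor_minus_left)

lemma kd_zero: "kd 0 = 0"
  using kd_add[of 0 0] by simp

lemma wedge_left_zero_form: "wedge_left 0 x = 0"
  using wedge_left_plus[of 0 0 x] by simp

text \<open>A normal form: sums are distributed, leading entries become \<open>wedge_left\<close>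
  and scalars move outwards as \<open>rmult\<close>. These rules run against
  \<open>wedge_left_tensor\<close> and \<open>rmult_tensor\<close>, which therefore leave the simp
  set.\<close>

lemmas mforms_expand = tensor_diff_left kd_zero wedge_left_zero_form tensor_scale_slot wedge_add wedge_repeat_adjacent tensor_add_right tensor_mult_expand tensor_wedge_Cons rmult_left_commute
  wedge_left_plus wedge_left_kscale wedge_left_rmult
  wedge_left.add wedge_left.diff wedge_left.minus wedge_left.zero
  rmult.add rmult.diff rmult.minus rmult.zero
  kd_add kd_mult kd_scaleC tensor_add_left tensor_minus_left

declare wedge_left_tensor [simp del] rmult_tensor [simp del]

abbreviation dform :: "'r::complex_comm_algebra \<Rightarrow> 'r list \<Rightarrow> 'r mforms" where
  "dform m as \<equiv> m \<otimes>\<^sub>R wedge (map kd as)"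

section \<open>Cartan calculus for a Poisson module\<close>

context poisson_module
begin

lemma br_skew: "br a b = - br b a"
proof -
  have "0 = br (a + b) (a + b)" by (simp add: br_self)
  also have "\<dots> = br a b + br b a" by (simp only: br_add_left br_add_right) (simp add: br_self)
  finally show ?thesis by (simp add: eq_neg_iff_add_eq_0)
qed

lemma br_mult_left: "br (a * b) c = br a c * b + a * br b c"
  using br_skew[of "a * b"] br_skew[of a c] br_skew[of b c] by (simp add: br_leibniz)

lemma br_one: "br a 1 = 0"
  using br_leibniz[of a 1 1] by simp

end

locale poisson_module_on_ring = poisson_module br "(*)" brM
  for br :: "'r::complex_comm_algebra \<Rightarrow> 'r \<Rightarrow> 'r" and brM :: "'r \<Rightarrow> 'r \<Rightarrow> 'r"
begin

text \<open>The Lie derivative along \<open>c\<close> in the convention of right modules: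
  \<open>c\<close> is bracketed from the right with the coefficient and with every entry, and the
  minus sign comes from \<open>br a c = - br c a\<close>.\<close>

primrec lie_derivative :: "'r \<Rightarrow> 'r \<Rightarrow> 'r list \<Rightarrow> 'r mforms" where
  "lie_derivative c m [] = dform (brM m c) []"
| "lie_derivative c m (a # as) =
     wedge_left (kd a) (lie_derivative c m as) - dform m (br c a # as)"

text \<open>Cartan's recursion taken as a definition, so that the slot rules can be proved by
  induction on the list. \<open>boundary_rec_eq\<close> identifies it with the double sum.\<close>

primrec boundary_rec :: "'r \<Rightarrow> 'r list \<Rightarrow> 'r mforms" where
  "boundary_rec m [] = 0"
| "boundary_rec m (a # as) = lie_derivative a m as - wedge_left (kd a) (boundary_rec m as)"

text \<open>Measures the failure of \<open>\<partial>\<close> to be \<open>R\<close>-linear.\<close>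

primrec contract :: "'r \<Rightarrow> 'r \<Rightarrow> 'r list \<Rightarrow> 'r mforms" where
  "contract r m [] = 0"
| "contract r m (a # as) = dform (m * br r a) as - wedge_left (kd a) (contract r m as)"

lemma brM_mult_left: "brM (m * r) c = brM m c * r - m * br c r"
  using act_br[of m c r] by simp

lemma scaleC_one_mult: "m * scaleC z 1 = scaleC z (m :: 'r)"
  by (metis mult.commute mult_1 scaleC_mult_left)

lemma scaleC_zero: "scaleC z 0 = (0 :: 'r)"
  using scaleC_add_right[of z 0 "0 :: 'r"] by simp

lemma br_scalar: "br x (scaleC z 1) = 0"
  by (simp add: br_scale_right br_one scaleC_zero)

text \<open>The correction arises at the empty list, from \<open>brM_mult_left\<close>; the other
  terms of the recursion are linear in \<open>m\<close>.\<close>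

lemma lie_derivative_mult:
  "lie_derivative c (m * r) as = rmult r (lie_derivative c m as) - dform (m * br c r) as"
  by (induct as) (simp_all add: brM_mult_left diff_conv_add_uminus mforms_expand
      del: add_uminus_conv_diff)

lemma lie_derivative_scalar:
  "lie_derivative c (m * scaleC z 1) as = rmult (scaleC z 1) (lie_derivative c m as)"
  by (simp add: lie_derivative_mult br_scalar)

text \<open>The corrections from \<open>lie_derivative_mult\<close>, one for each entry, add up to
  \<open>contract\<close>.\<close>

lemma boundary_rec_mult:
  "boundary_rec (m * r) as = rmult r (boundary_rec m as) + contract r m as"
proof (induct as)
  case (Cons a as)
  have "br a r = - br r a" by (rule br_skew)
  then show ?case by (simp add: Cons lie_derivative_mult mforms_expand)
qed (simp add: mforms_expand)

lemma lie_derivative_add: "lie_derivative c (m + m') as = lie_derivative c m as + lie_derivative c m' as"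
  by (induct as) (simp_all add: brM_add_left mforms_expand)

lemma boundary_rec_add: "boundary_rec (m + m') as = boundary_rec m as + boundary_rec m' as"
  by (induct as) (simp_all add: lie_derivative_add mforms_expand)

lemma lie_derivative_alternating: "alternating_derivation (lie_derivative c)"
proof
  fix m m' a b z as bs
  show "lie_derivative c (m + m') as = lie_derivative c m as + lie_derivative c m' as"
    by (rule lie_derivative_add)
  show "lie_derivative c m (as @ (a + b) # bs) =
    lie_derivative c m (as @ a # bs) + lie_derivative c m (as @ b # bs)"
    by (induct as) (simp_all add: br_add_right mforms_expand)
  show "lie_derivative c m (as @ scaleC z a # bs) = lie_derivative c (m * scaleC z 1) (as @ a # bs)"
    unfolding lie_derivative_scalar
    by (induct as) (simp_all add: br_scale_right mforms_expand)
  show "lie_derivative c m (as @ (a * b) # bs) =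
    lie_derivative c (m * b) (as @ a # bs) + lie_derivative c (m * a) (as @ b # bs)"
    unfolding lie_derivative_mult
    by (induct as) (simp_all add: br_leibniz mforms_expand)
  show "lie_derivative c m (as @ a # a # bs) = 0"
  proof (induct as)
    case Nil
    \<comment> \<open>What survives is \<open>d{c,a}\<close> wedged with \<open>da\<close> in both
      orders.\<close>
    have "wedge_left (kd a) (wedge_left (kd (br c a)) (dform m bs)) =
      - wedge_left (kd (br c a)) (wedge_left (kd a) (dform m bs))"
      by (rule wedge_left_swap)
    then show ?case by (simp add: mforms_expand)
  qed (simp add: mforms_expand)
qed

text \<open>The \<open>contract\<close> terms are exactly those that
  \<open>boundary_rec_mult\<close> produces when the Leibniz rule is checked in the first slot of
  \<open>boundary_rec\<close>.\<close>

lemma lie_derivative_leibniz: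
  "lie_derivative (a * b) m as = lie_derivative b (m * a) as + lie_derivative a (m * b) as
     - wedge_left (kd b) (contract a m as) - wedge_left (kd a) (contract b m as)"
proof (induct as)
  case Nil
  \<comment> \<open>Moving \<open>a\<close> and \<open>b\<close> out of the coefficients creates
    \<open>m * br b a\<close> and \<open>m * br a b\<close>, which cancel.\<close>
  have "br b a = - br a b" by (rule br_skew)
  then show ?case by (simp add: brM_mult brM_mult_left mforms_expand)
next
  case (Cons c as)
  have "wedge_left (kd c) (wedge_left (kd x) (contract y m as)) =
    - wedge_left (kd x) (wedge_left (kd c) (contract y m as))" for x y
    by (rule wedge_left_swap)
  then show ?case
    by (simp add: Cons br_mult_left mforms_expand)
qed

lemma lie_derivative_add_field:
  "lie_derivative (a + b) m as = lie_derivative a m as + lie_derivative b m as"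
  by (induct as) (simp_all add: brM_add_right br_add_left mforms_expand)

lemma lie_derivative_scaleC:
  "lie_derivative (scaleC z a) m as = rmult (scaleC z 1) (lie_derivative a m as)"
proof (induct as)
  case Nil
  have "brM m (scaleC z a) = brM m a * scaleC z 1"
    by (simp add: brM_scale_right scaleC_one_mult)
  then show ?case by (simp add: mforms_expand)
qed (simp_all add: br_scale_left mforms_expand)

lemma contract_scalar: "contract (scaleC z 1) m as = 0"
proof (induct as)
  case (Cons a as)
  have "br (scaleC z 1) a = 0" using br_skew[of "scaleC z 1" a] by (simp add: br_scalar)
  then show ?case by (simp add: Cons mforms_expand)
qed simp

lemma boundary_rec_alternating: "alternating_derivation boundary_rec"
proof
  interpret l: alternating_derivation "lie_derivative c" for c by (rule lie_derivative_alternating)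
  fix m m' a b z as bs
  show "boundary_rec (m + m') as = boundary_rec m as + boundary_rec m' as"
    by (rule boundary_rec_add)
  show "boundary_rec m (as @ (a + b) # bs) = boundary_rec m (as @ a # bs) + boundary_rec m (as @ b # bs)"
    by (induct as) (simp_all add: lie_derivative_add_field l.add_slot mforms_expand)
  show "boundary_rec m (as @ scaleC z a # bs) = boundary_rec (m * scaleC z 1) (as @ a # bs)"
    unfolding boundary_rec_mult contract_scalar
    by (induct as) (simp_all add: lie_derivative_scaleC lie_derivative_scalar l.scale_slot mforms_expand)
  show "boundary_rec m (as @ (a * b) # bs) =
    boundary_rec (m * b) (as @ a # bs) + boundary_rec (m * a) (as @ b # bs)"
  proof (induct as)
    case Nil
    show ?case by (simp add: lie_derivative_leibniz boundary_rec_mult mforms_expand)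
  next
    case (Cons c as)
    then show ?case by (simp add: l.mult_slot mforms_expand)
  qed
  \<comment> \<open>With \<open>a, a\<close> in front, the two terms \<open>da\<close> times the Lie
    derivative along \<open>a\<close> cancel, and \<open>{a,a}\<close> and the repeated
    \<open>da\<close> vanish.\<close>
  show "boundary_rec m (as @ a # a # bs) = 0"
    by (induct as) (simp_all add: l.repeat_slot br_self mforms_expand)
qed


section \<open>Agreement with the boundary formula, and existence of the boundary\<close>

text \<open>The sign is the cost of carrying \<open>d{c,a_j}\<close> to the front past the
  \<open>j\<close> earlier entries.\<close>

lemma lie_derivative_conv_sum:
  "lie_derivative c m as = dform (brM m c) as
     - (\<Sum>j<length as. zscale ((-1) ^ j) (dform m (br c (as ! j) # omit j as)))"
proof (induct as)
  case (Cons a as)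
  have "zscale ((-1) ^ j) (dform m (br c (as ! j) # a # omit j as)) =
      - wedge_left (kd a) (zscale ((-1) ^ j) (dform m (br c (as ! j) # omit j as)))" for j
    unfolding additive_zscale[OF wedge_left.additive_axioms]
    using wedge_left_swap[of "kd (br c (as ! j))" "kd a"] by (simp add: tensor_wedge_Cons)
  then have "(\<Sum>j<length (a # as). zscale ((-1) ^ j) (dform m (br c ((a # as) ! j) # omit j (a # as)))) =
      dform m (br c a # as) + wedge_left (kd a)
        (\<Sum>j<length as. zscale ((-1) ^ j) (dform m (br c (as ! j) # omit j as)))"
    unfolding wedge_left.sum by (simp add: sum.lessThan_Suc_shift omit_def del: sum.lessThan_Suc)
  then show ?case
    by (simp only: lie_derivative.simps Cons wedge_left.diff) (simp add: tensor_wedge_Cons)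
qed (simp add: omit_def)

text \<open>The terms of the formula that bracket with the first entry \<open>a\<close> form the Lie
  derivative along \<open>a\<close>. In all others \<open>da\<close> survives, and pulling it to the
  front gives minus \<open>da\<close> times the boundary of the tail.\<close>

lemma boundary_rec_eq: "boundary_rec m as = boundary_formula br brM m as"
proof (induct as)
  case (Cons a as)
  have 1: "(\<Sum>i<length (a # as). zscale ((-1) ^ i) (dform (brM m ((a # as) ! i)) (omit i (a # as)))) =
      dform (brM m a) as - wedge_left (kd a)
        (\<Sum>i<length as. zscale ((-1) ^ i) (dform (brM m (as ! i)) (omit i as)))"
    unfolding wedge_left.sum additive_zscale[OF wedge_left.additive_axioms]
    by (simp add: sum.lessThan_Suc_shift sum_negf omit_def tensor_wedge_Cons del: sum.lessThan_Suc)
  have swap: "dform m (br b c # a # bs) = - wedge_left (kd a) (dform m (br b c # bs))" for b c bs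
    using wedge_left_swap[of "kd (br b c)" "kd a"] by (simp add: tensor_wedge_Cons)
  have 2: "(\<Sum>j<length (a # as). \<Sum>i<j. zscale ((-1) ^ (i + j))
        (dform m (br ((a # as) ! i) ((a # as) ! j) # omit i (omit j (a # as))))) =
      - (\<Sum>j<length as. zscale ((-1) ^ j) (dform m (br a (as ! j) # omit j as)))
      - wedge_left (kd a) (\<Sum>j<length as. \<Sum>i<j. zscale ((-1) ^ (i + j))
        (dform m (br (as ! i) (as ! j) # omit i (omit j as))))"
    unfolding wedge_left.sum additive_zscale[OF wedge_left.additive_axioms]
    by (simp add: sum.lessThan_Suc_shift omit_def swap sum_negf sum_subtractf del: sum.lessThan_Suc list.map)
  show ?case
    unfolding boundary_formula_def 1 2 boundary_rec.simps lie_derivative_conv_sum Cons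
    by (simp add: wedge_left.add)
qed (simp add: boundary_formula_def)

lemma boundary_formula_alternating: "alternating_derivation (boundary_formula br brM)"
  using boundary_rec_alternating by (simp add: boundary_rec_eq[abs_def])

text \<open>Justifies the definite description: the lift of the formula is a witness, and it is
  unique because the elements \<open>dform m as\<close> generate the group.\<close>

lemma boundary_well_defined:
  shows additive_boundary: "Modules.additive (boundary br brM)"
    and boundary_dform: "boundary br brM (dform m as) = boundary_formula br brM m as"
proof -
  let ?P = "\<lambda>D. (\<forall>x y. D (x + y) = D x + D y) \<and> (\<forall>m as. D (dform m as) = boundary_formula br brM m as)"
  interpret alternating_derivation "boundary_formula br brM" by (rule boundary_formula_alternating)
  define D where "D = mforms_lift (kextend (boundary_formula br brM))"
  have D: "?P D"
    using additive.add[OF additive_mforms_lift[OF alternating_multilinear_kextend]]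
      mforms_lift_tensor[OF alternating_multilinear_kextend] kextend_kd
    unfolding D_def by simp
  moreover have "E = D" if "?P E" for E
  proof
    fix x
    from D that have add: "Modules.additive D" "Modules.additive E"
      by (simp_all add: Modules.additive_def)
    show "E x = D x"
      by (induct x rule: mforms_induct)
        (use D that in \<open>simp_all add: additive.minus[OF add(1)] additive.minus[OF add(2)]\<close>)
  qed
  ultimately have "?P (boundary br brM)"
    unfolding boundary_def by (rule theI)
  then show "Modules.additive (boundary br brM)"
    "boundary br brM (dform m as) = boundary_formula br brM m as"
    by (simp_all add: Modules.additive_def)
qed

end

section \<open>Log-canonical brackets\<close>

text \<open>A sign that makes sense in every abelian group, so that powers of -1 in the ring and
  \<open>zscale\<close> on forms are handled by the same rules.\<close>

definition alt_sign :: "nat \<Rightarrow> 'b::ab_group_add \<Rightarrow> 'b" where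
  "alt_sign n x = (if even n then x else - x)"

lemma alt_sign_Suc [simp]: "alt_sign (Suc n) x = - alt_sign n x"
  by (simp add: alt_sign_def)

lemma alt_sign_0 [simp]: "alt_sign 0 x = x"
  by (simp add: alt_sign_def)

lemma alt_sign_add: "alt_sign n (x + y) = alt_sign n x + alt_sign n y"
  by (simp add: alt_sign_def)

lemma alt_sign_minus [simp]: "alt_sign n (- x) = - alt_sign n x"
  by (simp add: alt_sign_def)

lemma alt_sign_opposite: "even m = odd n \<Longrightarrow> alt_sign m x = - alt_sign n x"
  by (simp add: alt_sign_def)

lemma alt_sign_alt_sign: "alt_sign m (alt_sign n x) = alt_sign (m + n) x"
  by (simp add: alt_sign_def)

lemma alt_sign_sum: "alt_sign n (sum f S) = (\<Sum>x\<in>S. alt_sign n (f x))"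
  by (simp add: alt_sign_def sum_negf)

lemma zscale_alt_sign: "zscale ((-1) ^ n) x = alt_sign n x"
  by (simp add: alt_sign_def minus_one_power_iff)

lemma mult_alt_sign: "(-1) ^ n * x = alt_sign n (x :: 'a::comm_ring_1)"
  by (simp add: alt_sign_def minus_one_power_iff)

lemma alt_sign_dform: "alt_sign n m \<otimes>\<^sub>R w = alt_sign n (m \<otimes>\<^sub>R w)"
  by (simp add: alt_sign_def tensor_minus_left)

lemma sum_symmetric_pairs:
  fixes g :: "nat \<Rightarrow> nat \<Rightarrow> 'b::ab_group_add"
  assumes "\<And>i. g i i = 0"
  shows "(\<Sum>j<n. \<Sum>i<j. g i j + g j i) = (\<Sum>i<n. \<Sum>j<n. g i j)"
  by (induct n) (simp_all add: assms sum.distrib add_ac)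

lemma length_omit [simp]: "i < length xs \<Longrightarrow> length (omit i xs) = length xs - 1"
  by (simp add: omit_def)

lemma nth_omit: "i < length xs \<Longrightarrow> p < length xs - 1 \<Longrightarrow> omit i xs ! p = (if p < i then xs ! p else xs ! Suc p)"
  by (auto simp: omit_def nth_append)

lemma omit_omit:
  assumes "i < j" "j < length xs"
  shows "omit i (omit j xs) = omit (j - 1) (omit i xs)"
proof (rule nth_equalityI)
  fix p assume "p < length (omit i (omit j xs))"
  then have "p < length xs - 2" using assms by simp
  then show "omit i (omit j xs) ! p = omit (j - 1) (omit i xs) ! p"
    using assms by (auto simp: nth_omit)
qed (use assms in simp)

section \<open>Collapse of the double sum for log-canonical brackets\<close>

context alternating_derivation
begin

lemma zero_left: "G 0 as = 0"
  using add_left[of 0 0 as] by simp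

lemma minus_left: "G (- m) as = - G m as"
  using add_left[of m "- m" as] by (simp add: zero_left eq_neg_iff_add_eq_0 add.commute)

lemma sum_left: "G (sum f S) as = (\<Sum>x\<in>S. G (f x) as)"
  by (induct S rule: infinite_finite_induct) (simp_all add: zero_left add_left)

lemma swap_slot: "G m (as @ a # b # bs) = - G m (as @ b # a # bs)"
proof -
  have "0 = G m (as @ (a + b) # (a + b) # bs)" by (simp add: repeat_slot)
  also have "\<dots> = G m (as @ a # (a + b) # bs) + G m (as @ b # (a + b) # bs)"
    by (rule add_slot)
  also have "\<dots> = G m (as @ a # b # bs) + G m (as @ b # a # bs)"
    using add_slot[of m "as @ [a]" a b bs] add_slot[of m "as @ [b]" a b bs]
    by (simp add: repeat_slot)
  finally show ?thesis by (simp add: eq_neg_iff_add_eq_0)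
qed

lemma move_slot: "G m (as @ a # bs @ cs) = alt_sign (length bs) (G m (as @ bs @ a # cs))"
proof (induct bs arbitrary: as)
  case (Cons b bs)
  then show ?case using swap_slot[of m as a b "bs @ cs"] Cons[of "as @ [b]"] by simp
qed simp

lemma move_nth: "p < length as \<Longrightarrow> G m (as ! p # omit p as) = alt_sign p (G m as)"
  using move_slot[of m "[]" "as ! p" "take p as" "drop (Suc p) as"]
  by (simp add: omit_def id_take_nth_drop[symmetric])

lemma of_int_slot: "G m (of_int z # bs) = 0"
proof -
  have 0: "G m (0 # bs) = 0" for m
    using add_slot[of m "[]" 0 0 bs] by simp
  \<comment> \<open>The Leibniz rule for \<open>1 * 1\<close> doubles this value.\<close>
  have 1: "G m (1 # bs) = 0" for m
    using mult_slot[of m "[]" 1 1 bs] by simp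
  show ?thesis
  proof (induct z rule: int_induct[where k = 0])
    case base
    show ?case using 0 by simp
  next
    case (step1 z)
    then show ?case using add_slot[of m "[]" "of_int z" 1 bs] 1[of m] by simp
  next
    case (step2 z)
    then show ?case using add_slot[of m "[]" "of_int (z - 1)" 1 bs] 1[of m] by simp
  qed
qed

lemma of_int_mult_slot: "G m (of_int z * a * b # bs) = G (m * of_int z * b) (a # bs) + G (m * of_int z * a) (b # bs)"
  using mult_slot[of m "[]" "of_int z * a" b bs] mult_slot[of "m * b" "[]" "of_int z" a bs]
  by (simp add: of_int_slot mult_ac)

text \<open>The Leibniz rule splits the slot \<open>{x_i,x_j}\<close> into a slot \<open>x_i\<close>
  and a slot \<open>x_j\<close>. Each returns to its own position, so that only the other entry
  stays omitted. The sum over \<open>i < j\<close> thus becomes one over all ordered pairs. It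
  serves both \<open>P\<close> and \<open>dform\<close>.\<close>

lemma log_canonical_sum:
  assumes br: "\<And>i j. i < length as \<Longrightarrow> j < length as \<Longrightarrow> br (as ! i) (as ! j) = of_int (c i j) * as ! i * as ! j"
    and skew: "\<And>i j. c j i = - c i j"
  shows "(\<Sum>j<length as. \<Sum>i<j. alt_sign (i + j) (G m (br (as ! i) (as ! j) # omit i (omit j as)))) =
    - (\<Sum>i<length as. alt_sign i (G (m * of_int (\<Sum>j<length as. c i j) * as ! i) (omit i as)))"
proof -
  \<comment> \<open>The share of the pair in which \<open>x_i\<close> has become a scalar and
    \<open>x_j\<close> is back in the list.\<close>
  define g where "g i j = - alt_sign i (G (m * of_int (c i j) * as ! i) (omit i as))" for i j
  have "c i i = 0" for i using skew[of i i] by simp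
  then have g0: "g i i = 0" for i by (simp add: g_def zero_left alt_sign_def)
  have "alt_sign (i + j) (G m (br (as ! i) (as ! j) # omit i (omit j as))) = g i j + g j i"
    if "i < j" "j < length as" for i j
  proof -
    have "G m' (as ! i # omit i (omit j as)) = alt_sign i (G m' (omit j as))" for m'
      using move_nth[of i "omit j as" m'] that by (simp add: nth_omit)
    \<comment> \<open>Omitting \<open>i < j\<close> shifts entry \<open>j\<close> to position
      \<open>j - 1\<close>; this shift makes the two halves differ in sign, which the skewness of
      \<open>c\<close> compensates.\<close>
    moreover have "omit i as ! (j - 1) = as ! j"
      using that by (cases j) (auto simp: nth_omit)
    then have "G m' (as ! j # omit i (omit j as)) = alt_sign (j - 1) (G m' (omit i as))" for m'
      using move_nth[of "j - 1" "omit i as" m'] that by (simp add: omit_omit)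
    ultimately have "alt_sign (i + j) (G m (br (as ! i) (as ! j) # omit i (omit j as))) =
      alt_sign (i + j + i) (G (m * of_int (c i j) * as ! j) (omit j as)) +
      alt_sign (i + j + (j - 1)) (G (m * of_int (c i j) * as ! i) (omit i as))"
      using that by (simp add: br of_int_mult_slot alt_sign_add alt_sign_alt_sign)
    also have "\<dots> = g j i + g i j"
    proof (rule arg_cong2[where f = "(+)"])
      show "alt_sign (i + j + i) (G (m * of_int (c i j) * as ! j) (omit j as)) = g j i"
        unfolding g_def skew[of j i] by (simp add: alt_sign_def minus_left)
      show "alt_sign (i + j + (j - 1)) (G (m * of_int (c i j) * as ! i) (omit i as)) = g i j"
        using that unfolding g_def by (cases j) (auto simp: alt_sign_def)
    qed
    finally show ?thesis by (simp add: add.commute)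
  qed
  then have "(\<Sum>j<length as. \<Sum>i<j. alt_sign (i + j) (G m (br (as ! i) (as ! j) # omit i (omit j as)))) =
    (\<Sum>j<length as. \<Sum>i<j. g i j + g j i)"
    by (intro sum.cong refl) simp
  also have "\<dots> = (\<Sum>i<length as. \<Sum>j<length as. g i j)"
    by (rule sum_symmetric_pairs) (rule g0)
  also have "\<dots> = - (\<Sum>i<length as. alt_sign i (G (m * of_int (\<Sum>j<length as. c i j) * as ! i) (omit i as)))"
    by (simp add: g_def sum_negf of_int_sum sum_distrib_left sum_distrib_right sum_left alt_sign_sum)
  finally show ?thesis .
qed

end

lemma dform_alternating: "alternating_derivation (dform :: 'r::complex_comm_algebra \<Rightarrow> _)"
  by standard (simp_all add: mforms_expand tensor_add_left)

text \<open>The free factor \<open>m\<close> gives multiderivations the same shape as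
  \<open>dform\<close>, so one collapse lemma covers both operators.\<close>

lemma multideriv_alternating:
  fixes P :: "'a::complex_comm_algebra list \<Rightarrow> 'a"
  assumes "P \<in> multiderivs k"
  shows "alternating_derivation (\<lambda>m as. m * P as)"
proof
  fix m m' a b :: 'a and z and as bs :: "'a list"
  have len: "\<And>fs. length fs \<noteq> k \<Longrightarrow> P fs = 0"
    and swap: "\<And>fs i j. length fs = k \<Longrightarrow> i < k \<Longrightarrow> j < k \<Longrightarrow> i \<noteq> j \<Longrightarrow>
        P (fs[i := fs ! j, j := fs ! i]) = - P fs"
    and add: "\<And>fs i a b. length fs = k \<Longrightarrow> i < k \<Longrightarrow> P (fs[i := a + b]) = P (fs[i := a]) + P (fs[i := b])"
    and scale: "\<And>fs i z a. length fs = k \<Longrightarrow> i < k \<Longrightarrow> P (fs[i := scaleC z a]) = scaleC z (P (fs[i := a]))"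
    and mult: "\<And>fs i a b. length fs = k \<Longrightarrow> i < k \<Longrightarrow> P (fs[i := a * b]) = a * P (fs[i := b]) + b * P (fs[i := a])"
    using assms by (simp_all add: multiderivs_def)
  let ?fs = "as @ 0 # bs"
  have upd: "?fs[length as := x] = as @ x # bs" for x by simp
  show "(m + m') * P as = m * P as + m' * P as" by (simp add: distrib_right)
  show "m * P (as @ (a + b) # bs) = m * P (as @ a # bs) + m * P (as @ b # bs)"
    using add[of ?fs "length as" a b] by (cases "length ?fs = k") (auto simp: len algebra_simps)
  show "m * P (as @ scaleC z a # bs) = m * scaleC z 1 * P (as @ a # bs)"
  proof (cases "length ?fs = k")
    case True
    then have "P (as @ scaleC z a # bs) = scaleC z 1 * P (as @ a # bs)"
      using scale[of ?fs "length as" z a] by (simp add: scaleC_mult_left)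
    then show ?thesis by (simp add: mult.assoc)
  qed (auto simp: len)
  show "m * P (as @ (a * b) # bs) = m * b * P (as @ a # bs) + m * a * P (as @ b # bs)"
    using mult[of ?fs "length as" a b] by (cases "length ?fs = k") (auto simp: len algebra_simps)
  show "m * P (as @ a # a # bs) = 0"
  proof (cases "length (as @ a # a # bs) = k")
    case True
    let ?gs = "as @ a # a # bs"
    have "?gs[length as := ?gs ! Suc (length as), Suc (length as) := ?gs ! length as] = ?gs"
      by (simp add: nth_append list_update_append)
    then have "P ?gs = - P ?gs"
      using swap[of ?gs "length as" "Suc (length as)"] True by simp
    \<comment> \<open>Swapping the equal entries fixes the list, so the value is its own negative.
      The complex scalar 1/2 removes the factor 2.\<close>
    then have "scaleC 2 (P ?gs) = 0"
      using scaleC_add_left[of 1 1 "P ?gs"] by (simp add: scaleC_one eq_neg_iff_add_eq_0)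
    then have "scaleC (1/2) (scaleC 2 (P ?gs)) = scaleC (1/2) 0" by simp
    moreover have "scaleC (1/2) (0::'a) = 0" using scaleC_add_right[of "1/2" 0 "0::'a"] by simp
    ultimately show ?thesis by (simp add: scaleC_scaleC scaleC_one)
  qed (auto simp: len)
qed

lemma coboundary_log_canonical:
  assumes "P \<in> multiderivs k"
    and "\<And>i j. i < length fs \<Longrightarrow> j < length fs \<Longrightarrow> br (fs ! i) (fs ! j) = of_int (c i j) * fs ! i * fs ! j"
    and "\<And>i j. c j i = - c i j"
  shows "coboundary br P fs = (\<Sum>i<length fs. alt_sign i
    (br (fs ! i) (P (omit i fs)) - of_int (\<Sum>j<length fs. c i j) * fs ! i * P (omit i fs)))"
  using alternating_derivation.log_canonical_sum[OF multideriv_alternating[OF assms(1)], of fs br c 1, OF assms(2,3)]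
  by (simp add: coboundary_def mult_alt_sign alt_sign_add sum.distrib diff_conv_add_uminus sum_negf
      del: add_uminus_conv_diff)

lemma boundary_formula_log_canonical:
  assumes "\<And>i j. i < length as \<Longrightarrow> j < length as \<Longrightarrow> br (as ! i) (as ! j) = of_int (c i j) * as ! i * as ! j"
    and "\<And>i j. c j i = - c i j"
  shows "boundary_formula br brM m as = (\<Sum>i<length as. alt_sign i
    (dform (brM m (as ! i) - m * of_int (\<Sum>j<length as. c i j) * as ! i) (omit i as)))"
  using alternating_derivation.log_canonical_sum[OF dform_alternating, of as br c m, OF assms]
  by (simp add: boundary_formula_def zscale_alt_sign tensor_add_left tensor_minus_left alt_sign_add sum.distrib
      diff_conv_add_uminus sum_negf del: add_uminus_conv_diff)

section \<open>Shuffles and subsets\<close>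

lemma map_strict_mono_on_eq:
  fixes f :: "nat \<Rightarrow> nat"
  assumes "strict_mono_on {a..b} f"
  shows "map f [a..<Suc b] = sorted_list_of_set (f ` {a..b})"
proof -
  have "sorted_wrt (<) (map f [a..<Suc b])"
    unfolding sorted_wrt_map
    by (rule sorted_wrt_mono_rel[OF _ sorted_wrt_upt]) (use assms in \<open>auto simp: strict_mono_on_def\<close>)
  moreover have "f ` {a..b} = set (map f [a..<Suc b])"
    by auto
  ultimately show ?thesis
    by (metis strict_sorted_equal sorted_list_of_set.set_sorted_key_list_of_set finite_imageI
        finite_atLeastAtMost strict_sorted_list_of_set)
qed

lemma shuffles_perm_maps:
  assumes "\<sigma> \<in> shuffles_perm k n" "k \<le> n"
  shows "map \<sigma> [1..<Suc k] = sorted_list_of_set (\<sigma> ` {1..k})"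
    and "map \<sigma> [Suc k..<Suc n] = sorted_list_of_set ({1..n} - \<sigma> ` {1..k})"
proof -
  have \<sigma>: "\<sigma> permutes {1..n}" "strict_mono_on {1..k} \<sigma>" "strict_mono_on {Suc k..n} \<sigma>"
    using assms by (auto simp: shuffles_perm_def)
  show "map \<sigma> [1..<Suc k] = sorted_list_of_set (\<sigma> ` {1..k})"
    by (rule map_strict_mono_on_eq[OF \<sigma>(2)])
  have "{Suc k..n} = {1..n} - {1..k}" using assms(2) by auto
  then have "\<sigma> ` {Suc k..n} = {1..n} - \<sigma> ` {1..k}"
    using permutes_image[OF \<sigma>(1)] by (simp add: image_set_diff[OF permutes_inj[OF \<sigma>(1)]])
  then show "map \<sigma> [Suc k..<Suc n] = sorted_list_of_set ({1..n} - \<sigma> ` {1..k})"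
    using map_strict_mono_on_eq[OF \<sigma>(3)] by simp
qed

text \<open>The image of the first block determines both blocks as increasing lists, and outside
  \<open>{1..n}\<close> a shuffle is the identity.\<close>

lemma inj_on_shuffles_perm:
  assumes "k \<le> n"
  shows "inj_on (\<lambda>\<sigma>. \<sigma> ` {1..k}) (shuffles_perm k n)"
proof (rule inj_onI)
  fix \<sigma> \<tau> assume *: "\<sigma> \<in> shuffles_perm k n" "\<tau> \<in> shuffles_perm k n" "\<sigma> ` {1..k} = \<tau> ` {1..k}"
  then have eq: "map \<sigma> [1..<Suc k] = map \<tau> [1..<Suc k]"
      "map \<sigma> [Suc k..<Suc n] = map \<tau> [Suc k..<Suc n]"
    using shuffles_perm_maps assms by metis+
  show "\<sigma> = \<tau>"
  proof
    fix i
    consider "i \<in> {1..k}" | "i \<in> {Suc k..n}" | "i \<notin> {1..n}" by fastforce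
    then show "\<sigma> i = \<tau> i"
    proof cases
      case 3
      then show ?thesis using * by (simp add: shuffles_perm_def permutes_def)
    qed (use eq in \<open>auto simp del: upt_Suc\<close>)
  qed
qed

lemma bij_betw_shuffles_perm:
  assumes "k \<le> n"
  shows "bij_betw (\<lambda>\<sigma>. \<sigma> ` {1..k}) (shuffles_perm k n) {S. S \<subseteq> {1..n} \<and> card S = k}"
proof -
  have "\<sigma> ` {1..k} \<subseteq> {1..n} \<and> card (\<sigma> ` {1..k}) = k" if "\<sigma> \<in> shuffles_perm k n" for \<sigma>
  proof -
    have \<sigma>: "\<sigma> permutes {1..n}" using that by (simp add: shuffles_perm_def)
    have "\<sigma> ` {1..k} \<subseteq> \<sigma> ` {1..n}" using assms by (intro image_mono) auto
    then show ?thesis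
      using permutes_image[OF \<sigma>] card_image[OF permutes_inj_on[OF \<sigma>], of "{1..k}"] by simp
  qed
  moreover have "\<exists>\<sigma>\<in>shuffles_perm k n. S = \<sigma> ` {1..k}" if S: "S \<subseteq> {1..n}" "card S = k" for S
  proof -
    \<comment> \<open>The shuffle that selects \<open>S\<close> lists \<open>S\<close> and then its
      complement, both increasingly. List positions start at 0, hence \<open>i - 1\<close>
      below.\<close>
    define xs where "xs = sorted_list_of_set S @ sorted_list_of_set ({1..n} - S)"
    define \<sigma> where "\<sigma> i = (if i \<in> {1..n} then xs ! (i - 1) else i)" for i
    have fin: "finite S" using S(1) finite_subset by blast
    have len: "length xs = n" "length (sorted_list_of_set S) = k"
      using S fin assms by (simp_all add: xs_def card_Diff_subset)
    have "distinct xs" "set xs = {1..n}"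
      using S fin by (auto simp: xs_def)
    then have "bij_betw ((!) xs) {..<n} {1..n}"
      using bij_betw_nth[of xs "{..<n}" "{1..n}"] len by simp
    moreover have "bij_betw (\<lambda>i. i - 1) {1..n} {..<n}"
      by (rule bij_betwI[where g = Suc]) auto
    ultimately have "bij_betw (\<lambda>i. xs ! (i - 1)) {1..n} {1..n}"
      using bij_betw_trans[of "\<lambda>i. i - 1" "{1..n}" "{..<n}" "(!) xs"] by (simp add: comp_def)
    moreover have "bij_betw \<sigma> {1..n} {1..n} \<longleftrightarrow> bij_betw (\<lambda>i. xs ! (i - 1)) {1..n} {1..n}"
      by (rule bij_betw_cong) (simp add: \<sigma>_def)
    ultimately have "bij_betw \<sigma> {1..n} {1..n}" by blast
    then have 1: "\<sigma> permutes {1..n}"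
      by (rule bij_imp_permutes) (auto simp: \<sigma>_def)
    have \<sigma>1: "\<sigma> i = sorted_list_of_set S ! (i - 1)" if "i \<in> {1..k}" for i
      using that assms len by (auto simp: \<sigma>_def xs_def nth_append)
    have \<sigma>2: "\<sigma> i = sorted_list_of_set ({1..n} - S) ! (i - Suc k)" if "i \<in> {Suc k..n}" for i
    proof -
      have "i - Suc 0 - k = i - Suc k" by simp
      then show ?thesis
        using that len unfolding \<sigma>_def xs_def nth_append by auto
    qed
    have 2: "strict_mono_on {1..k} \<sigma>"
    proof (rule strict_mono_onI)
      fix r s assume "r \<in> {1..k}" "s \<in> {1..k}" "r < s"
      then show "\<sigma> r < \<sigma> s"
        using sorted_wrt_nth_less[OF strict_sorted_list_of_set[of S], of "r - 1" "s - 1"] len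
        by (auto simp: \<sigma>1)
    qed
    have 3: "strict_mono_on {Suc k..n} \<sigma>"
    proof (rule strict_mono_onI)
      fix r s assume rs: "r \<in> {Suc k..n}" "s \<in> {Suc k..n}" "r < s"
      have "length (sorted_list_of_set ({1..n} - S)) = n - k"
        using len by (simp add: xs_def)
      then show "\<sigma> r < \<sigma> s"
        using rs sorted_wrt_nth_less[OF strict_sorted_list_of_set[of "{1..n} - S"], of "r - Suc k" "s - Suc k"]
        unfolding \<sigma>2[OF rs(1)] \<sigma>2[OF rs(2)] by auto
    qed
    have "map \<sigma> [1..<Suc k] = sorted_list_of_set S"
      by (rule nth_equalityI) (use len in \<open>auto simp: \<sigma>1 simp del: upt_Suc\<close>)
    then have "S = set (map \<sigma> [1..<Suc k])" using fin by simp
    then have "S = \<sigma> ` {1..k}" by (simp add: atLeastLessThanSuc_atLeastAtMost del: upt_Suc)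
    then show ?thesis using 1 2 3 by (auto simp: shuffles_perm_def)
  qed
  ultimately show ?thesis
    unfolding bij_betw_def using inj_on_shuffles_perm[OF assms] by (auto simp: image_iff)
qed

section \<open>The sign of a shuffle\<close>

text \<open>Descent on the sum of the selected values: unless the shuffle is the identity, some
  selected \<open>v\<close> has \<open>v - 1\<close> unselected. Exchanging these two values gives a
  shuffle with opposite sign and sum one smaller.\<close>

lemma sign_shuffles_perm:
  assumes "\<sigma> \<in> shuffles_perm k n" "k \<le> n"
  shows "sign \<sigma> = (-1) ^ ((\<Sum>i=1..k. \<sigma> i) + \<Sum>{1..k})"
  using assms(1)
proof (induct "\<Sum>i=1..k. \<sigma> i" arbitrary: \<sigma> rule: less_induct)
  case less
  have \<sigma>: "\<sigma> permutes {1..n}" "strict_mono_on {1..k} \<sigma>" "strict_mono_on {Suc k..n} \<sigma>"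
    using less(2) by (auto simp: shuffles_perm_def)
  have inj: "\<sigma> x = \<sigma> y \<longleftrightarrow> x = y" for x y
    using permutes_inj[OF \<sigma>(1)] by (simp add: inj_eq)
  show ?case
  proof (cases "\<forall>i\<in>{1..k}. \<sigma> i = i")
    case True
    have "id \<in> shuffles_perm k n"
      by (auto simp: shuffles_perm_def permutes_id strict_mono_on_def)
    moreover have "\<sigma> ` {1..k} = id ` {1..k}" using True by simp
    ultimately have "\<sigma> = id"
      using inj_on_shuffles_perm[OF assms(2)] less(2) by (simp add: inj_on_def)
    \<comment> \<open>For the identity the two sums in the exponent agree, so it is even.\<close>
    then show ?thesis by (simp add: sign_id power_add[symmetric] mult_2[symmetric])
  next
    case False
    define i where "i = (LEAST i. i \<in> {1..k} \<and> \<sigma> i \<noteq> i)"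
    have i: "i \<in> {1..k}" "\<sigma> i \<noteq> i"
      using LeastI_ex[of "\<lambda>i. i \<in> {1..k} \<and> \<sigma> i \<noteq> i"] False unfolding i_def by blast+
    have below: "\<sigma> j = j" if "j < i" for j
    proof (cases "j = 0")
      case True
      then show ?thesis using \<sigma>(1) by (simp add: permutes_def)
    next
      case False
      then show ?thesis using not_less_Least[of j] that i(1) unfolding i_def by fastforce
    qed
    define v where "v = \<sigma> i"
    have "v > i"
      using below[of v] inj[of v i] i(2) unfolding v_def by (metis linorder_neqE_nat)
    have vk: "v \<in> {1..n}" using permutes_in_image[OF \<sigma>(1), of i] i(1) assms(2) by (simp add: v_def)
    \<comment> \<open>Positions before \<open>i\<close> are fixed, so their values are below
      \<open>i\<close> and hence below \<open>v - 1\<close>; positions from \<open>i\<close> on have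
      values at least \<open>v\<close>.\<close>
    have pred: "\<sigma> j \<noteq> v - 1" if "j \<in> {1..k}" for j
    proof (cases "j < i")
      case True
      then show ?thesis using below[OF True] \<open>v > i\<close> by simp
    next
      case False
      then have "v \<le> \<sigma> j"
        using strict_mono_onD[OF \<sigma>(2) i(1) that] unfolding v_def by (cases "i = j") auto
      then show ?thesis using \<open>v > i\<close> by simp
    qed
    define \<tau> where "\<tau> = transpose (v - 1) v \<circ> \<sigma>"
    have "\<tau> permutes {1..n}"
      unfolding \<tau>_def using vk \<open>v > i\<close> i(1) by (intro permutes_compose \<sigma>(1) permutes_swap_id) auto
    moreover have "strict_mono_on {1..k} \<tau>"
    proof (rule strict_mono_onI)
      fix r s assume "r \<in> {1..k}" "s \<in> {1..k}" "r < s"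
      then show "\<tau> r < \<tau> s"
        using strict_mono_onD[OF \<sigma>(2), of r s] pred[of r] pred[of s]
        by (auto simp: \<tau>_def transpose_def)
    qed
    \<comment> \<open>The value \<open>v\<close> is taken in the first block. In the second block
      only \<open>v - 1\<close> can change, and raising it to the missing value \<open>v\<close>
      keeps the order.\<close>
    moreover have "strict_mono_on {Suc k..n} \<tau>"
    proof (rule strict_mono_onI)
      fix r s assume "r \<in> {Suc k..n}" "s \<in> {Suc k..n}" "r < s"
      moreover from this have "\<sigma> r \<noteq> v" "\<sigma> s \<noteq> v"
        using i(1) by (auto simp: v_def inj)
      ultimately show "\<tau> r < \<tau> s"
        using strict_mono_onD[OF \<sigma>(3), of r s]
        by (auto simp: \<tau>_def transpose_def)
    qed
    ultimately have \<tau>: "\<tau> \<in> shuffles_perm k n" by (simp add: shuffles_perm_def)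
    have "\<tau> j = \<sigma> j" if "j \<in> {1..k} - {i}" for j
      using that pred[of j] inj[of j i] by (auto simp: \<tau>_def v_def transpose_def)
    then have rest: "(\<Sum>j\<in>{1..k} - {i}. \<tau> j) = (\<Sum>j\<in>{1..k} - {i}. \<sigma> j)" by simp
    have "\<tau> i = v - 1" by (simp add: \<tau>_def v_def)
    then have sum: "(\<Sum>i=1..k. \<sigma> i) = Suc (\<Sum>i=1..k. \<tau> i)"
      using \<open>v > i\<close> rest sum.remove[OF _ i(1), of \<sigma>] sum.remove[OF _ i(1), of \<tau>]
      by (simp add: v_def[symmetric])
    have "sign \<tau> = (-1) ^ ((\<Sum>i=1..k. \<tau> i) + \<Sum>{1..k})"
      using less(1)[OF _ \<tau>] sum by simp
    moreover have "sign \<tau> = - sign \<sigma>"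
      unfolding \<tau>_def using permutes_imp_permutation[OF _ \<sigma>(1)] \<open>v > i\<close>
      by (subst sign_compose) (auto simp: sign_swap_id permutation_swap_id)
    ultimately show ?thesis using sum by simp
  qed
qed

section \<open>Sums over subsets and their elements\<close>

abbreviation variables :: "(nat \<Rightarrow> 'n) \<Rightarrow> nat set \<Rightarrow> 'n cpoly list" where
  "variables \<iota> S \<equiv> map (\<lambda>i. X (\<iota> i)) (sorted_list_of_set S)"

lemma dag_conv_subsets:
  fixes \<iota> :: "nat \<Rightarrow> 'n::finite"
  shows "dag \<iota> k P = (\<Sum>S | S \<subseteq> {1..CARD('n)} \<and> card S = k.
    alt_sign (\<Sum>S + \<Sum>{1..k}) (dform (P (variables \<iota> S)) (variables \<iota> ({1..CARD('n)} - S))))"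
proof (cases "k \<le> CARD('n)")
  case True
  let ?n = "CARD('n)"
  have *: "zscale (sign \<sigma>)
            (P (map (\<lambda>i. X (\<iota> (\<sigma> i))) [1..<Suc k])
               \<otimes>\<^sub>R wedge (map (\<lambda>i. kd (X (\<iota> (\<sigma> i)))) [Suc k..<Suc ?n])) =
      alt_sign (\<Sum>(\<sigma> ` {1..k}) + \<Sum>{1..k})
        (dform (P (variables \<iota> (\<sigma> ` {1..k}))) (variables \<iota> ({1..?n} - \<sigma> ` {1..k})))"
    if "\<sigma> \<in> shuffles_perm k ?n" for \<sigma>
  proof -
    have "\<Sum>(\<sigma> ` {1..k}) = (\<Sum>i=1..k. \<sigma> i)"
      using that by (subst sum.reindex) (auto simp: shuffles_perm_def intro: permutes_inj_on)
    then show ?thesis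
      unfolding sign_shuffles_perm[OF that True] shuffles_perm_maps[OF that True, symmetric]
      by (simp add: zscale_alt_sign comp_def del: upt_Suc)
  qed
  have "dag \<iota> k P = (\<Sum>\<sigma>\<in>shuffles_perm k ?n. alt_sign (\<Sum>(\<sigma> ` {1..k}) + \<Sum>{1..k})
        (dform (P (variables \<iota> (\<sigma> ` {1..k}))) (variables \<iota> ({1..?n} - \<sigma> ` {1..k}))))"
    unfolding dag_def if_P[OF True] by (rule sum.cong[OF refl *])
  also have "\<dots> = (\<Sum>S | S \<subseteq> {1..?n} \<and> card S = k.
      alt_sign (\<Sum>S + \<Sum>{1..k}) (dform (P (variables \<iota> S)) (variables \<iota> ({1..?n} - S))))"
    by (rule sum.reindex_bij_betw[OF bij_betw_shuffles_perm[OF True]])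
  finally show ?thesis .
next
  case False
  \<comment> \<open>There are no subsets of this size, and \<open>dag\<close> is 0 by definition.
    The coboundary side of the theorem meets this case when \<open>k\<close> is the number of
    variables.\<close>
  have "card S \<le> CARD('n)" if "S \<subseteq> {1..CARD('n)}" for S :: "nat set"
    using card_mono[OF _ that] by simp
  then have "{S. S \<subseteq> {1..CARD('n)} \<and> card S = k} = {}" using False by auto
  then show ?thesis using False by (simp only: dag_def if_False sum.empty)
qed

text \<open>Trades positions for elements: the position of \<open>t\<close> in the sorted list is
  the number of elements below \<open>t\<close>, which then enters the signs.\<close>

lemma sum_sorted_list_positions:
  fixes U :: "nat set"
  assumes "finite U"
  shows "(\<Sum>i<length (sorted_list_of_set U). f i (sorted_list_of_set U ! i) (omit i (sorted_list_of_set U)))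
    = (\<Sum>t\<in>U. f (card {u\<in>U. u < t}) t (sorted_list_of_set (U - {t})))"
proof -
  let ?xs = "sorted_list_of_set U"
  have bij: "bij_betw ((!) ?xs) {..<length ?xs} U"
    by (rule bij_betw_nth) (use assms in auto)
  have *: "card {u\<in>U. u < ?xs ! i} = i \<and> sorted_list_of_set (U - {?xs ! i}) = omit i ?xs"
    if i: "i < length ?xs" for i
  proof -
    have xs: "?xs = take i ?xs @ ?xs ! i # drop (Suc i) ?xs"
      by (rule id_take_nth_drop[OF i])
    have sorted: "sorted_wrt (<) (take i ?xs @ ?xs ! i # drop (Suc i) ?xs)"
      by (subst xs[symmetric]) simp
    have U: "U = set (take i ?xs @ ?xs ! i # drop (Suc i) ?xs)"
      by (subst xs[symmetric]) (use assms in simp)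
    have "U - {?xs ! i} = set (omit i ?xs)"
      using sorted by (subst U) (auto simp: sorted_wrt_append omit_def)
    moreover have "sorted_wrt (<) (omit i ?xs)"
      using sorted by (simp add: sorted_wrt_append omit_def)
    ultimately have 1: "sorted_list_of_set (U - {?xs ! i}) = omit i ?xs"
      by (metis strict_sorted_equal sorted_list_of_set.set_sorted_key_list_of_set List.finite_set
          strict_sorted_list_of_set)
    have "{u\<in>U. u < ?xs ! i} = set (take i ?xs)"
      using sorted by (subst U) (auto simp: sorted_wrt_append)
    then have "card {u\<in>U. u < ?xs ! i} = i"
      using i by (simp add: distinct_card)
    with 1 show ?thesis by blast
  qed
  have "(\<Sum>t\<in>U. f (card {u\<in>U. u < t}) t (sorted_list_of_set (U - {t})))
    = (\<Sum>i<length ?xs. f (card {u\<in>U. u < ?xs ! i}) (?xs ! i) (sorted_list_of_set (U - {?xs ! i})))"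
    by (rule sum.reindex_bij_betw[OF bij, symmetric])
  also have "\<dots> = (\<Sum>i<length ?xs. f i (?xs ! i) (omit i ?xs))"
    by (intro sum.cong refl) (simp add: *)
  finally show ?thesis by simp
qed

lemma omit_map: "omit i (map f xs) = map f (omit i xs)"
  by (simp add: omit_def take_map drop_map)

lemma sum_sorted_list: "finite (U :: nat set) \<Longrightarrow> (\<Sum>i<card U. f (sorted_list_of_set U ! i)) = sum f U"
  using sum_sorted_list_positions[of U "\<lambda>i t us. f t"] by simp

section \<open>Matching the coboundary and boundary terms\<close>

theorem proposition3p4p1:
  fixes A :: "int ^ 'n ^ 'n"
    and \<iota> :: "nat \<Rightarrow> 'n::finite"
    and br :: "'n cpoly \<Rightarrow> 'n cpoly \<Rightarrow> 'n cpoly"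
    and brM :: "'n cpoly \<Rightarrow> 'n cpoly \<Rightarrow> 'n cpoly"
    and k :: nat
    and P :: "'n cpoly list \<Rightarrow> 'n cpoly"
  assumes "Finite_Cartesian_Product.transpose A = - A"
    and "bij_betw \<iota> {1..CARD('n)} UNIV"
    and "poisson_algebra br"
    and "\<And>i j. br (X i) (X j) = of_int (A $ i $ j) * X i * X j"
    and "poisson_module br (*) brM"
    and "\<And>m i. brM m (X i) = - br (X i) m + of_int (\<Sum>l\<in>UNIV. A $ i $ l) * X i * m"
    and "k \<le> CARD('n)"
    and "P \<in> multiderivs k"
  shows "dag \<iota> (k + 1) (coboundary br P) = zscale ((-1) ^ (k + 1)) (boundary br brM (dag \<iota> k P))"
proof -
  interpret poisson_module br "(*)" brM by (rule assms(5))
  interpret poisson_module_on_ring br brM by standard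
  interpret D: Modules.additive "boundary br brM" by (rule additive_boundary)
  let ?N = "{1..CARD('n)}"
  define a where "a i j = A $ (\<iota> i) $ (\<iota> j)" for i j
  have skew: "a j i = - a i j" for i j
    using assms(1) unfolding a_def
    by (metis (no_types, lifting) Finite_Cartesian_Product.transpose_def
        vec_lambda_beta vector_uminus_component)
  have br: "br (X (\<iota> i)) (X (\<iota> j)) = of_int (a i j) * X (\<iota> i) * X (\<iota> j)" for i j
    unfolding a_def by (rule assms(4))
  have a0: "a i i = 0" for i using skew[of i i] by simp
  \<comment> \<open>The term of a pair \<open>(S, t)\<close> common to both sides, up to
    sign.\<close>
  define Q where "Q t S = br (X (\<iota> t)) (P (variables \<iota> S))
      - of_int (\<Sum>s\<in>S. a t s) * X (\<iota> t) * P (variables \<iota> S)" for t S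
  have cob: "coboundary br P (variables \<iota> T) = (\<Sum>t\<in>T. alt_sign (card {u\<in>T. u < t}) (Q t (T - {t})))"
    if "finite T" for T
  proof -
    let ?xs = "sorted_list_of_set T"
    \<comment> \<open>The collapse sums over all of \<open>T\<close>; the summand at
      \<open>t\<close> is a diagonal entry of a skew matrix, hence 0.\<close>
    have eq: "(\<Sum>s\<in>T. a t s) = (\<Sum>s\<in>T - {t}. a t s)" for t
      by (rule sum.mono_neutral_right) (use that a0 in auto)
    have "coboundary br P (variables \<iota> T) = (\<Sum>i<length ?xs. alt_sign i
      (br (X (\<iota> (?xs ! i))) (P (map (\<lambda>i. X (\<iota> i)) (omit i ?xs))) -
        of_int (\<Sum>j\<in>T. a (?xs ! i) j) * X (\<iota> (?xs ! i)) * P (map (\<lambda>i. X (\<iota> i)) (omit i ?xs))))"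
      by (subst coboundary_log_canonical[OF assms(8), where c = "\<lambda>i j. a (?xs ! i) (?xs ! j)"])
        (simp add: br, rule skew, simp add: omit_map sum_sorted_list[OF that] del: of_int_sum)
    also have "\<dots> = (\<Sum>t\<in>T. alt_sign (card {u\<in>T. u < t}) (Q t (T - {t})))"
      unfolding sum_sorted_list_positions[OF that, of "\<lambda>i t us. alt_sign i (br (X (\<iota> t)) (P (map (\<lambda>i. X (\<iota> i)) us)) -
        of_int (\<Sum>j\<in>T. a t j) * X (\<iota> t) * P (map (\<lambda>i. X (\<iota> i)) us))"]
      by (simp only: Q_def eq)
    finally show ?thesis .
  qed
  have bound: "boundary br brM (dform (P (variables \<iota> S)) (variables \<iota> (?N - S))) =
      - (\<Sum>t\<in>?N - S. alt_sign (card {u\<in>?N - S. u < t}) (dform (Q t S) (variables \<iota> (?N - S - {t}))))"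
    if S: "S \<subseteq> ?N" for S
  proof -
    let ?xs = "sorted_list_of_set (?N - S)"
    let ?m = "P (variables \<iota> S)"
    have fin: "finite (?N - S)" "finite S" using S by (auto intro: finite_subset)
    \<comment> \<open>The full row sum in the external bracket loses its part outside
      \<open>S\<close>; the part over \<open>S\<close> remains, as in \<open>Q\<close>.\<close>
    have eq: "brM ?m (X (\<iota> t)) - ?m * of_int (\<Sum>j\<in>?N - S. a t j) * X (\<iota> t) = - Q t S" for t
    proof -
      have "(\<Sum>l\<in>UNIV. A $ \<iota> t $ l) = (\<Sum>j\<in>?N. a t j)"
        unfolding a_def by (rule sum.reindex_bij_betw[OF assms(2), symmetric])
      also have "\<dots> = (\<Sum>j\<in>?N - S. a t j) + (\<Sum>j\<in>S. a t j)"
        by (rule sum.subset_diff[OF S]) simp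
      finally show ?thesis
        unfolding assms(6) Q_def by (simp add: algebra_simps del: of_int_sum)
    qed
    have "boundary_formula br brM ?m (variables \<iota> (?N - S)) = (\<Sum>i<length ?xs. alt_sign i
      (dform (brM ?m (X (\<iota> (?xs ! i))) - ?m * of_int (\<Sum>j\<in>?N - S. a (?xs ! i) j) * X (\<iota> (?xs ! i)))
        (map (\<lambda>i. X (\<iota> i)) (omit i ?xs))))"
      by (subst boundary_formula_log_canonical[where c = "\<lambda>i j. a (?xs ! i) (?xs ! j)"])
        (simp add: br, rule skew, simp add: omit_map sum_sorted_list[OF fin(1)] del: of_int_sum One_nat_def)
    also have "\<dots> = (\<Sum>t\<in>?N - S. alt_sign (card {u\<in>?N - S. u < t}) (dform (- Q t S) (variables \<iota> (?N - S - {t}))))"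
      unfolding eq by (rule sum_sorted_list_positions[OF fin(1),
        of "\<lambda>i t us. alt_sign i (dform (- Q t S) (map (\<lambda>i. X (\<iota> i)) us))"])
    finally show ?thesis
      unfolding boundary_dform by (simp add: tensor_minus_left sum_negf)
  qed
  have D_alt: "boundary br brM (alt_sign i x) = alt_sign i (boundary br brM x)" for i x
    by (simp add: alt_sign_def D.minus)
  let ?W = "\<lambda>t S. dform (Q t S) (variables \<iota> (?N - S - {t}))"
  let ?S = "\<lambda>k. {S. S \<subseteq> ?N \<and> card S = k}"
  have fin: "finite (?S k)" "S \<subseteq> ?N \<Longrightarrow> finite S" for k S
    by (auto intro: finite_subset)
  have "dag \<iota> (k + 1) (coboundary br P) =
    (\<Sum>T\<in>?S (k + 1). \<Sum>t\<in>T. alt_sign (\<Sum>T + \<Sum>{1..k+1} + card {u\<in>T. u < t}) (?W t (T - {t})))"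
  proof -
    have "dform (coboundary br P (variables \<iota> T)) (variables \<iota> (?N - T)) =
        (\<Sum>t\<in>T. alt_sign (card {u\<in>T. u < t}) (?W t (T - {t})))" if T: "T \<in> ?S (k + 1)" for T
    proof -
      have "finite T" using T fin(2) by blast
      interpret d: alternating_derivation "dform :: 'n cpoly \<Rightarrow> _" by (rule dform_alternating)
      have "?N - (T - {t}) - {t} = ?N - T" if "t \<in> T" for t using that by auto
      then show ?thesis
        unfolding cob[OF \<open>finite T\<close>] d.sum_left by (intro sum.cong refl) (simp add: alt_sign_dform)
    qed
    then show ?thesis
      unfolding dag_conv_subsets
      by (intro sum.cong refl) (simp only: alt_sign_sum alt_sign_alt_sign)
  qed
  also have "\<dots> = (\<Sum>(T, t)\<in>Sigma (?S (k + 1)) (\<lambda>T. T).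
      alt_sign (\<Sum>T + \<Sum>{1..k+1} + card {u\<in>T. u < t}) (?W t (T - {t})))"
    by (rule sum.Sigma) (simp_all add: fin)
  \<comment> \<open>Passing from \<open>(T, t)\<close> to \<open>(T - {t}, t)\<close> replaces the
    choice of an element of \<open>T\<close> by that of an element outside \<open>S\<close>.\<close>
  also have "\<dots> = (\<Sum>(S, t)\<in>Sigma (?S k) (\<lambda>S. ?N - S).
      - alt_sign (k + 1 + (\<Sum>S + \<Sum>{1..k}) + card {u\<in>?N - S. u < t}) (?W t S))"
  proof (rule sum.reindex_bij_witness[where i = "\<lambda>(S, t). (insert t S, t)" and j = "\<lambda>(T, t). (T - {t}, t)"],
      goal_cases)
    case (1 p)
    then show ?case by auto
  next
    case (2 p)
    then obtain T t where "p = (T, t)" "T \<subseteq> ?N" "card T = k + 1" "t \<in> T" by auto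
    then show ?case using fin(2)[of T] by auto
  next
    case (3 p)
    then show ?case by auto
  next
    case (4 p)
    then obtain S t where "p = (S, t)" "S \<subseteq> ?N" "card S = k" "t \<in> ?N - S" by auto
    then show ?case using fin(2)[of S] by auto
  next
    case (5 p)
    then obtain T t where p: "p = (T, t)" "T \<subseteq> ?N" "card T = k + 1" "t \<in> T" by auto
    have "finite T" using p(2) finite_subset by blast
    define S where "S = T - {t}"
    have "finite S" using \<open>finite T\<close> by (simp add: S_def)
    have T: "\<Sum>T = t + \<Sum>S" unfolding S_def by (rule sum.remove[OF \<open>finite T\<close> p(4)])
    \<comment> \<open>Below \<open>t\<close> the sets \<open>T\<close> and \<open>S\<close> agree,
      so each of the \<open>t - 1\<close> smaller numbers is counted on exactly one side.\<close>
    have "{u\<in>T. u < t} \<union> {u\<in>?N - S. u < t} = {1..<t}"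
      using p(2,4) by (auto simp: S_def)
    moreover have "{u\<in>T. u < t} \<inter> {u\<in>?N - S. u < t} = {}"
      using p(4) by (auto simp: S_def)
    ultimately have "card {u\<in>T. u < t} + card {u\<in>?N - S. u < t} = t - 1"
      using card_Un_disjoint[of "{u\<in>T. u < t}" "{u\<in>?N - S. u < t}"] \<open>finite T\<close> by simp
    moreover have "t \<ge> 1" using p(2,4) by auto
    ultimately have cards: "Suc (card {u\<in>T. u < t} + card {u\<in>?N - S. u < t}) = t" by simp
    have k: "\<Sum>{1..k+1} = k + 1 + \<Sum>{1..k}" by simp
    \<comment> \<open>The exponents differ by \<open>t + p - q\<close>, which is
      \<open>2 * p + 1\<close> because \<open>p + q = t - 1\<close>.\<close>
    have "even (t + s + (k + 1 + w) + p) \<longleftrightarrow> odd (k + 1 + (s + w) + q)"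
      if "Suc (p + q) = t" for p q s w :: nat
      using that by presburger
    from this[OF cards] have "even (\<Sum>T + \<Sum>{1..k+1} + card {u\<in>T. u < t}) \<longleftrightarrow>
        odd (k + 1 + (\<Sum>S + \<Sum>{1..k}) + card {u\<in>?N - S. u < t})"
      unfolding T k .
    then show ?case
      unfolding p(1) prod.case S_def[symmetric] by (simp only: alt_sign_opposite)
  qed
  also have "\<dots> = (\<Sum>S\<in>?S k. \<Sum>t\<in>?N - S.
      - alt_sign (k + 1 + (\<Sum>S + \<Sum>{1..k}) + card {u\<in>?N - S. u < t}) (?W t S))"
    by (rule sum.Sigma[symmetric]) (simp_all add: fin)
  also have "\<dots> = alt_sign (k + 1) (boundary br brM (dag \<iota> k P))"
    unfolding dag_conv_subsets D.sum alt_sign_sum[of "k + 1"] D_alt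
  proof (intro sum.cong refl)
    fix S assume "S \<in> ?S k"
    then have S: "S \<subseteq> ?N" by blast
    show "(\<Sum>t\<in>?N - S. - alt_sign (k + 1 + (\<Sum>S + \<Sum>{1..k}) + card {u\<in>?N - S. u < t}) (?W t S)) =
      alt_sign (k + 1) (alt_sign (\<Sum>S + \<Sum>{1..k})
        (boundary br brM (dform (P (variables \<iota> S)) (variables \<iota> (?N - S)))))"
      unfolding bound[OF S] alt_sign_minus alt_sign_sum alt_sign_alt_sign sum_negf add.assoc by (rule refl)
  qed
  finally show ?thesis by (simp add: zscale_alt_sign)
qed

end
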